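(* Let $Q=\bigcap_{i\in I}\langle f_i\rangle\subset\mathbb{K}[[X_1,X_2]]$ be a plane algebroid curve with branches $\langle f_i\rangle$, $i\in I=\{1,\ldots,r\}$, $r\geq 2$, and let $\Gamma$ be its set of values. Then the set of irreducible absolute points of $\Gamma$ having some coordinate equal to $\infty$ is $\{v(f_i):\ i\in I\}$ (where $v(f_i)$ is the value of the image of $f_i$ in $\mathcal{O}=\mathbb{K}[[X_1,X_2]]/Q$).
   Context: Let $\mathbb{K}$ be an algebraically closed field. A plane algebroid curve is a proper radical ideal $Q=\bigcap_{i=1}^{r}\langle f_i\rangle=\langle f_1\cdots f_r\rangle\subset\mathbb{K}[[X_1,X_2]]$, where the $f_i$ are irreducible, pairwise non-associate power series; the prime ideals $\langle f_i\rangle$ are the branches, and $\mathcal{O}_i=\mathbb{K}[[X_1,X_2]]/\langle f_i\rangle$. Standing assumptions: $r\geq 2$, and $Q$ is non-degenerate, i.e. $\dim_{\mathbb{K}}\mathcal{M}/\mathcal{M}^2=2$, where $\mathcal{M}$ is the maximal ideal of $\mathcal{O}=\mathbb{K}[[X_1,X_2]]/Q$. Put $\mathbb{N}=\{0,1,2,\ldots\}$ and $\overline{\mathbb{N}}=\mathbb{N}\cup\{\infty\}$, with $a+\infty=\infty$ for all $a$. The integral closure of $\mathcal{O}_i$ in its field of fractions is a discrete valuation ring isomorphic to $\mathbb{K}[[t_i]]$, with normalized valuation $v_i$ ($v_i(0)=\infty$). For $g\in\mathcal{O}$, $v_i(g)$ denotes the value under $v_i$ of the image of $g$ in $\mathcal{O}_i$,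 and $v(g)=(v_1(g),\ldots,v_r(g))\in\overline{\mathbb{N}}^r$. The set of values is $\Gamma=\{v(g):g\in\mathcal{O}\}\subseteq\overline{\mathbb{N}}^r$; it is closed under componentwise addition. Write $\underline{0}=(0,\ldots,0)$ and $\underline{\infty}=(\infty,\ldots,\infty)$. An element $\gamma\in\Gamma\setminus\{\underline{0}\}$ is irreducible if $\gamma=\alpha+\beta$ with $\alpha,\beta\in\Gamma$ implies $\alpha=\gamma$ or $\beta=\gamma$. (With $r\geq2$, $\underline{\infty}$ is not irreducible.) For $\gamma\in\overline{\mathbb{N}}^r\setminus\{\underline{\infty}\}$ put $I_\gamma=\{i\in I:\gamma_i\neq\infty\}$. For $\gamma\in\Gamma\setminus\{\underline{\infty}\}$ and $J\subsetneq I_\gamma$ put $F_J(\gamma)=\{\alpha\in\Gamma:\ \alpha_i>\gamma_i \text{ for } i\in I_\gamma\setminus J \text{ and } \alpha_j=\gamma_j \text{ for } j\in I\setminus(I_\gamma\setminus J)\}$. Then $\gamma$ is an absolute (maximal) point of $\Gamma$ if $F_J(\gamma)=\emptyset$ for every nonempty proper subset $J$ of $I_\gamma$ (in particular, $\gamma$ is absolute when $I_\gamma$ has only one element). *)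

theory Defs
  imports
    "HOL-Algebra.Algebraic_Closure_Type"
    "HOL-Algebra.Embedded_Algebras"
    "HOL-Algebra.Ideal_Product"
    "HOL-Algebra.Ring_Divisibility"
    "HOL-Computational_Algebra.Formal_Power_Series"
    "HOL-Library.Extended_Nat"
    "HOL-Analysis.Finite_Cartesian_Product"
begin

section \<open>Fraction field, integral closure and normalized valuation of a domain\<close>

text \<open>The fraction \<open>a / b\<close> is the set of all pairs \<open>(c, d)\<close> with \<open>d\<close> nonzero and
  \<open>a d = c b\<close>; if \<open>D\<close> is a domain, these sets are the classes of the usual equivalence relation.\<close>

definition fraction :: "('a, 'm) ring_scheme \<Rightarrow> 'a \<Rightarrow> 'a \<Rightarrow> ('a \<times> 'a) set" where
  "fraction D a b = {(c, d). c \<in> carrier D \<and> d \<in> carrier D - {\<zero>\<^bsub>D\<^esub>} \<and>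
                         a \<otimes>\<^bsub>D\<^esub> d = c \<otimes>\<^bsub>D\<^esub> b}"

text \<open>In \<open>mult\<close> and \<open>add\<close> the fractions over which the unions are taken all
  coincide when \<open>D\<close> is a domain.\<close>

definition fraction_field :: "('a, 'm) ring_scheme \<Rightarrow> ('a \<times> 'a) set ring" where
  "fraction_field D =
    \<lparr>carrier = {fraction D a b | a b. a \<in> carrier D \<and> b \<in> carrier D - {\<zero>\<^bsub>D\<^esub>}},
     monoid.mult = (\<lambda>x y. \<Union>(a, b)\<in>x. \<Union>(c, d)\<in>y. fraction D (a \<otimes>\<^bsub>D\<^esub> c) (b \<otimes>\<^bsub>D\<^esub> d)),
     one = fraction D \<one>\<^bsub>D\<^esub> \<one>\<^bsub>D\<^esub>,
     zero = fraction D \<zero>\<^bsub>D\<^esub> \<one>\<^bsub>D\<^esub>,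
     add = (\<lambda>x y. \<Union>(a, b)\<in>x. \<Union>(c, d)\<in>y.
              fraction D ((a \<otimes>\<^bsub>D\<^esub> d) \<oplus>\<^bsub>D\<^esub> (c \<otimes>\<^bsub>D\<^esub> b)) (b \<otimes>\<^bsub>D\<^esub> d))\<rparr>"

definition to_fraction_field :: "('a, 'm) ring_scheme \<Rightarrow> 'a \<Rightarrow> ('a \<times> 'a) set" where
  "to_fraction_field D a = fraction D a \<one>\<^bsub>D\<^esub>"

text \<open>Polynomials are coefficient lists with the leading coefficient first, as expected by
  \<^const>\<open>ring.eval\<close>.\<close>

definition integral_over :: "('a, 'm) ring_scheme \<Rightarrow> 'a set \<Rightarrow> 'a \<Rightarrow> bool" where
  "integral_over L A x \<longleftrightarrow>
     (\<exists>p. p \<noteq> [] \<and> hd p = \<one>\<^bsub>L\<^esub> \<and> set p \<subseteq> A \<and> ring.eval L p x = \<zero>\<^bsub>L\<^esub>)"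

definition integral_closure :: "('a, 'm) ring_scheme \<Rightarrow> ('a \<times> 'a) set ring" where
  "integral_closure D = fraction_field D
     \<lparr>carrier := {x \<in> carrier (fraction_field D).
        integral_over (fraction_field D) (to_fraction_field D ` carrier D) x}\<rparr>"

text \<open>The normalized valuation of a discrete valuation ring \<open>V\<close>: a nonzero \<open>x\<close> is a unit times
  \<open>p\<^sup>n\<close> with \<open>p\<close> a generator of the maximal ideal, and \<open>n\<close> is its value.\<close>

definition dvr_valuation :: "('a, 'm) ring_scheme \<Rightarrow> 'a \<Rightarrow> enat" where
  "dvr_valuation V x =
     (if x = \<zero>\<^bsub>V\<^esub> then \<infinity>
      else enat (THE n. \<exists>p u. p \<in> carrier V \<and> maximalideal (PIdl\<^bsub>V\<^esub> p) V \<and>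
                              u \<in> Units V \<and> x = u \<otimes>\<^bsub>V\<^esub> p [^]\<^bsub>V\<^esub> (n::nat)))"

section \<open>Plane algebroid curves\<close>

abbreviation power_series_ring :: "'k::field fps fps ring" where
  "power_series_ring \<equiv> ring_of_type_algebra"

definition branch_equations :: "('i \<Rightarrow> 'k::field fps fps) \<Rightarrow> bool" where
  "branch_equations f \<longleftrightarrow>
     (\<forall>i. ring_irreducible\<^bsub>power_series_ring\<^esub> (f i)) \<and>
     (\<forall>i j. i \<noteq> j \<longrightarrow> \<not> f i \<sim>\<^bsub>power_series_ring\<^esub> f j)"

definition curve_ideal :: "('i \<Rightarrow> 'k::field fps fps) \<Rightarrow> 'k fps fps set" where
  "curve_ideal f = (\<Inter>i. PIdl\<^bsub>power_series_ring\<^esub> (f i))"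

definition curve_ring :: "('i \<Rightarrow> 'k::field fps fps) \<Rightarrow> 'k fps fps set ring" where
  "curve_ring f = power_series_ring Quot curve_ideal f"

definition to_curve_ring :: "('i \<Rightarrow> 'k::field fps fps) \<Rightarrow> 'k fps fps \<Rightarrow> 'k fps fps set" where
  "to_curve_ring f g = curve_ideal f +>\<^bsub>power_series_ring\<^esub> g"

definition curve_max_ideal :: "('i \<Rightarrow> 'k::field fps fps) \<Rightarrow> 'k fps fps set set" where
  "curve_max_ideal f = (THE M. maximalideal M (curve_ring f))"

text \<open>\<open>M / M\<^sup>2\<close> is regarded as a subspace of the algebra \<open>\<O> / M\<^sup>2\<close> over the image of \<open>\<K>\<close>.\<close>

definition nondegenerate_curve :: "('i \<Rightarrow> 'k::field fps fps) \<Rightarrow> bool" where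
  "nondegenerate_curve f \<longleftrightarrow>
     (let M = curve_max_ideal f;
          M2 = M \<cdot>\<^bsub>curve_ring f\<^esub> M;
          proj = (\<lambda>x. M2 +>\<^bsub>curve_ring f\<^esub> x)
      in ring.dimension (curve_ring f Quot M2) 2
           (range (\<lambda>c. proj (to_curve_ring f (fps_const (fps_const c)))))
           (proj ` M))"

definition branch_ring :: "('i \<Rightarrow> 'k::field fps fps) \<Rightarrow> 'i \<Rightarrow> 'k fps fps set ring" where
  "branch_ring f i = power_series_ring Quot (PIdl\<^bsub>power_series_ring\<^esub> (f i))"

text \<open>The canonical map \<open>\<O> \<rightarrow> \<O>\<^sub>i\<close> sends a coset \<open>Q + g\<close> to \<open>\<langle>f\<^sub>i\<rangle> + (Q + g) = \<langle>f\<^sub>i\<rangle> + g\<close>.\<close>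

definition to_branch_ring ::
    "('i \<Rightarrow> 'k::field fps fps) \<Rightarrow> 'i \<Rightarrow> 'k fps fps set \<Rightarrow> 'k fps fps set" where
  "to_branch_ring f i x = PIdl\<^bsub>power_series_ring\<^esub> (f i) <+>\<^bsub>power_series_ring\<^esub> x"

definition branch_valuation ::
    "('i \<Rightarrow> 'k::field fps fps) \<Rightarrow> 'i \<Rightarrow> 'k fps fps set \<Rightarrow> enat" where
  "branch_valuation f i x =
     dvr_valuation (integral_closure (branch_ring f i))
       (to_fraction_field (branch_ring f i) (to_branch_ring f i x))"

definition value_vector ::
    "('i::finite \<Rightarrow> 'k::field fps fps) \<Rightarrow> 'k fps fps set \<Rightarrow> enat ^ 'i" where
  "value_vector f x = (\<chi> i. branch_valuation f i x)"

definition value_set :: "('i::finite \<Rightarrow> 'k::field fps fps) \<Rightarrow> (enat ^ 'i) set" where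
  "value_set f = value_vector f ` carrier (curve_ring f)"

section \<open>Irreducible and absolute points\<close>

definition irreducible_point :: "(enat ^ 'i) set \<Rightarrow> enat ^ 'i \<Rightarrow> bool" where
  "irreducible_point \<Gamma> \<gamma> \<longleftrightarrow>
     \<gamma> \<in> \<Gamma> - {0} \<and> (\<forall>\<alpha>\<in>\<Gamma>. \<forall>\<beta>\<in>\<Gamma>. \<gamma> = \<alpha> + \<beta> \<longrightarrow> \<alpha> = \<gamma> \<or> \<beta> = \<gamma>)"

definition finite_coords :: "enat ^ 'i \<Rightarrow> 'i set" where
  "finite_coords \<gamma> = {i. \<gamma> $ i \<noteq> \<infinity>}"

definition fiber :: "(enat ^ 'i) set \<Rightarrow> 'i set \<Rightarrow> enat ^ 'i \<Rightarrow> (enat ^ 'i) set" where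
  "fiber \<Gamma> J \<gamma> = {\<alpha> \<in> \<Gamma>. (\<forall>i \<in> finite_coords \<gamma> - J. \<alpha> $ i > \<gamma> $ i) \<and>
                           (\<forall>j \<in> - (finite_coords \<gamma> - J). \<alpha> $ j = \<gamma> $ j)}"

definition absolute_point :: "(enat ^ 'i) set \<Rightarrow> enat ^ 'i \<Rightarrow> bool" where
  "absolute_point \<Gamma> \<gamma> \<longleftrightarrow>
     \<gamma> \<in> \<Gamma> - {(\<chi> i. \<infinity>)} \<and> (\<forall>J. J \<noteq> {} \<and> J \<subset> finite_coords \<gamma> \<longrightarrow> fiber \<Gamma> J \<gamma> = {})"

end

theory Submission
  imports Defs "HOL-Computational_Algebra.Polynomial_Factorial" "HOL-Computational_Algebra.Polynomial_FPS"
begin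

text \<open>Let \<open>v\<^sub>i(g)\<close> be the \<open>i\<close>-th coordinate of the value of a power series \<open>g\<close>. The theorem depends
  on three properties of the maps \<open>v\<^sub>i\<close> only: they are additive, \<open>v\<^sub>i(g) = \<infinity>\<close> holds iff \<open>f\<^sub>i\<close>
  divides \<open>g\<close>, and \<open>v\<^sub>i(g) = 0\<close> holds iff \<open>g\<close> is a unit of the local ring of power series, a
  condition that does not depend on \<open>i\<close>.

  Let \<open>v(g)\<close> be an irreducible absolute point with an infinite coordinate. Then \<open>g = f\<^sub>i h\<close> for
  some \<open>i\<close>, so that \<open>v(g) = v(f\<^sub>i) + v(h)\<close>, and one of the summands is \<open>v(g)\<close>. It is not
  \<open>v(h)\<close>: comparing the two at a finite coordinate \<open>j\<close> would give \<open>v\<^sub>j(f\<^sub>i) = 0\<close>, although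
  \<open>f\<^sub>i\<close> is not a unit. Conversely, the only infinite coordinate of \<open>v(f\<^sub>i)\<close> is the \<open>i\<close>-th one.
  In a decomposition of \<open>v(f\<^sub>i)\<close>, one summand is infinite at \<open>i\<close>, so it is the value of a multiple
  of \<open>f\<^sub>i\<close>, and the other one vanishes at some \<open>j \<noteq> i\<close>, hence everywhere. Likewise, a point of a
  fiber at \<open>v(f\<^sub>i)\<close> is the value of some \<open>f\<^sub>i h\<close> and agrees with \<open>v(f\<^sub>i)\<close> at some \<open>j \<noteq> i\<close>; then
  \<open>h\<close> is a unit, and the two points agree everywhere.

  The three properties (\<open>branch_valuation_properties\<close>) hold because the integral closure of
  \<open>\<O>\<^sub>i\<close> is a discrete valuation ring whose units meet \<open>\<O>\<^sub>i\<close> in the units of \<open>\<O>\<^sub>i\<close>. To see this,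
  regard power series in two variables as series in \<open>Y\<close> over \<open>K[[X]]\<close>. By Weierstrass
  preparation, \<open>\<O>\<^sub>i\<close> is \<open>K[[X]][\<theta>]\<close> for a root \<open>\<theta>\<close> of a distinguished polynomial over \<open>K[[X]]\<close>,
  a subring of an algebraic closure of \<open>K((X))\<close>; if \<open>f\<^sub>i\<close> is associated with \<open>X\<close>, it is
  \<open>K[[Y]]\<close>, and \<open>Y\<close> takes the place of \<open>X\<close> in what follows
  (\<open>branch_parametrization_exists\<close>). An element of its field of fractions is integral iff its
  powers have a common denominator \<open>X\<^sup>N\<close>, and such elements obviously form a ring
  (\<open>integral_iff_power_bounded\<close>). Hensel's lemma shows that of \<open>z\<close> and \<open>1/z\<close> one is integral, so
  the integral closure is a valuation ring; it is discrete because the degrees of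
  the elements over \<open>K[[X]]\<close> are bounded, which bounds the ramification (\<open>uniformizer_exists\<close>).\<close>

section \<open>Weierstrass division and Hensel's lemma over power series\<close>

lemma fps_dvd_1_if_nth_0_dvd_1:
  fixes f :: "'a::comm_ring_1 fps"
  assumes "fps_nth f 0 dvd 1"
  shows "f dvd 1"
proof -
  obtain y where y: "fps_nth f 0 * y = 1"
    using assms by (metis dvdE)
  have "f * fps_right_inverse f y = 1"
    by (rule fps_right_inverse) (use y in auto)
  then show ?thesis by (metis dvdI)
qed

lemma fps_X_power_dvd_iff:
  fixes a :: "'a::comm_ring_1 fps"
  shows "fps_X ^ k dvd a \<longleftrightarrow> (\<forall>i<k. fps_nth a i = 0)"
proof
  assume "fps_X ^ k dvd a"
  then show "\<forall>i<k. fps_nth a i = 0" by (auto simp: fps_X_power_mult_nth elim!: dvdE)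
next
  assume "\<forall>i<k. fps_nth a i = 0"
  then have "a = fps_X ^ k * fps_shift k a"
    by (intro fps_ext) (auto simp: fps_X_power_mult_nth)
  then show "fps_X ^ k dvd a" by (metis dvdI)
qed

lemma fps_X_dvd_iff:
  fixes a :: "'a::comm_ring_1 fps"
  shows "fps_X dvd a \<longleftrightarrow> fps_nth a 0 = 0"
  using fps_X_power_dvd_iff[of 1 a] by simp

lemma fps_eq_0_if_fps_X_powers_dvd:
  fixes a :: "'a::comm_ring_1 fps"
  assumes "\<And>k. fps_X ^ k dvd a"
  shows "a = 0"
  using assms by (intro fps_ext) (auto simp: fps_X_power_dvd_iff)

text \<open>The coefficient of \<open>X\<^sup>i\<close> of the infinite sum only involves the summands with \<open>k \<le> i\<close>.\<close>

lemma fps_X_adic_sum_exists: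
  fixes h :: "nat \<Rightarrow> 'a::comm_ring_1 fps"
  shows "\<exists>s. \<forall>m. fps_X ^ m dvd s - (\<Sum>k<m. fps_X ^ k * h k)"
proof (intro exI allI)
  fix m
  let ?s = "Abs_fps (\<lambda>i. \<Sum>k\<le>i. fps_nth (h k) (i - k))"
  have "fps_nth ?s i = fps_nth (\<Sum>k<m. fps_X ^ k * h k) i" if "i < m" for i
  proof -
    have "fps_nth (\<Sum>k<m. fps_X ^ k * h k) i = (\<Sum>k<m. if k \<le> i then fps_nth (h k) (i - k) else 0)"
      by (auto simp: fps_sum_nth fps_X_power_mult_nth intro!: sum.cong)
    also have "\<dots> = (\<Sum>k\<in>{k\<in>{..<m}. k \<le> i}. fps_nth (h k) (i - k))"
      by (rule sum.inter_filter[symmetric]) simp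
    also have "{k\<in>{..<m}. k \<le> i} = {..i}" using that by auto
    finally show ?thesis by simp
  qed
  then show "fps_X ^ m dvd ?s - (\<Sum>k<m. fps_X ^ k * h k)"
    by (auto simp: fps_X_power_dvd_iff)
qed

lemma coefficientwise_fps_X_adic_sum_exists:
  fixes h :: "nat \<Rightarrow> 'a::comm_ring_1 fps fps"
  shows "\<exists>s. \<forall>m i. fps_X ^ m dvd fps_nth (s - (\<Sum>k<m. fps_const (fps_X ^ k) * h k)) i"
proof -
  have "\<forall>i. \<exists>s. \<forall>m. fps_X ^ m dvd s - (\<Sum>k<m. fps_X ^ k * fps_nth (h k) i)"
    by (intro allI fps_X_adic_sum_exists)
  then obtain s where s: "\<forall>i m. fps_X ^ m dvd s i - (\<Sum>k<m. fps_X ^ k * fps_nth (h k) i)"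
    by metis
  then show ?thesis
    by (intro exI[of _ "Abs_fps s"]) (simp add: fps_sum_nth)
qed

text \<open>In \<open>A[[Y]]\<close> with \<open>A = K[[X]]\<close>, such a series has order \<open>n\<close> in \<open>Y\<close> modulo \<open>X\<close>.\<close>

definition weierstrass_regular :: "nat \<Rightarrow> 'a::comm_ring_1 fps fps \<Rightarrow> bool" where
  "weierstrass_regular n f \<longleftrightarrow> (\<forall>i<n. fps_X dvd fps_nth f i) \<and> fps_nth f n dvd 1"

text \<open>Modulo \<open>X\<close>, the series \<open>f\<close> is \<open>Y\<^sup>n\<close> times a unit, so \<open>X\<close> divides \<open>q\<close> as soon as it divides
  the coefficients of \<open>q f\<close> from \<open>Y\<^sup>n\<close> on. After division by \<open>X\<close> the same argument applies again.
  With all \<open>k\<close> together, this is the uniqueness of the quotient in Weierstrass division.\<close>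

lemma weierstrass_regular_dvd_quotient:
  fixes f q :: "'a::field fps fps"
  assumes f: "weierstrass_regular n f"
    and dvd: "\<And>i. i \<ge> n \<Longrightarrow> fps_X ^ k dvd fps_nth (q * f) i"
  shows "fps_X ^ k dvd fps_nth q j"
  using dvd
proof (induction k arbitrary: q j)
  case (Suc k)
  have "fps_X ^ k dvd fps_nth q j" for j
    by (rule Suc.IH) (use Suc.prems in \<open>auto dest: dvd_mult_right\<close>)
  then obtain b where b: "\<And>j. fps_nth q j = fps_X ^ k * b j"
    unfolding dvd_def by metis
  define q' where "q' = Abs_fps b"
  have q: "q = fps_const (fps_X ^ k) * q'"
    by (rule fps_ext) (simp add: q'_def b)
  have X: "fps_X dvd fps_nth (q' * f) i" if "i \<ge> n" for i
  proof -
    have "fps_X ^ k * fps_X dvd fps_X ^ k * fps_nth (q' * f) i"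
      using Suc.prems[OF that] unfolding q mult.assoc by (simp add: mult.commute[of fps_X])
    then show ?thesis by (subst (asm) dvd_times_left_cancel_iff) auto
  qed
  \<comment> \<open>If j is the first index for which this is false, the coefficient n + j of q' f is not divisible by X.\<close>
  have "fps_X dvd fps_nth q' j" for j
  proof (induction j rule: less_induct)
    case (less j)
    have "fps_X dvd (\<Sum>i\<in>{0..n+j} - {j}. fps_nth q' i * fps_nth f (n + j - i))"
    proof (rule dvd_sum)
      fix i assume i: "i \<in> {0..n+j} - {j}"
      show "fps_X dvd fps_nth q' i * fps_nth f (n + j - i)"
      proof (cases "i < j")
        case True
        then show ?thesis using less by auto
      next
        case False
        then have "n + j - i < n" using i by auto
        then show ?thesis using f by (auto simp: weierstrass_regular_def)
      qed
    qed
    moreover have "fps_nth (q' * f) (n + j) =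
        fps_nth q' j * fps_nth f n + (\<Sum>i\<in>{0..n+j} - {j}. fps_nth q' i * fps_nth f (n + j - i))"
      by (subst fps_mult_nth, subst sum.remove[of _ j]) auto
    ultimately have "fps_X dvd fps_nth q' j * fps_nth f n"
      using X[of "n + j"] by (simp add: dvd_add_left_iff)
    then show ?case
      using f by (auto simp: weierstrass_regular_def dvd_mult_unit_iff)
  qed
  then show ?case by (simp add: q mult.commute mult_dvd_mono)
qed simp

lemma weierstrass_quotient_unique:
  fixes f q :: "'a::field fps fps"
  assumes f: "weierstrass_regular n f"
    and z: "\<And>i. i \<ge> n \<Longrightarrow> fps_nth (q * f) i = 0"
  shows "q = 0"
proof (rule fps_ext)
  fix j
  show "fps_nth q j = fps_nth 0 j"
    using fps_eq_0_if_fps_X_powers_dvd[of "fps_nth q j"] weierstrass_regular_dvd_quotient[OF f, of _ q j] z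
    by simp
qed

text \<open>Write \<open>f = Y\<^sup>n u + X b\<close> with a unit \<open>u\<close>. Division by \<open>Y\<^sup>n u\<close> only cuts \<open>g\<close> at \<open>Y\<^sup>n\<close>, and
  the summand \<open>X b\<close> causes an error \<open>X g'\<close>. Continuing with \<open>g'\<close>, the quotients and the remainders
  add up to \<open>X\<close>-adically convergent sums.\<close>

lemma weierstrass_division:
  fixes f g :: "'a::field fps fps"
  assumes f: "weierstrass_regular n f"
  shows "\<exists>q p. g = q * f + fps_of_poly p \<and> (\<forall>i\<ge>n. poly.coeff p i = 0)"
proof -
  define u where "u = fps_shift n f"
  have "u dvd 1"
    by (rule fps_dvd_1_if_nth_0_dvd_1) (use f in \<open>simp add: u_def weierstrass_regular_def\<close>)
  then obtain v where uv: "u * v = 1" by (metis dvdE)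
  have step: "\<exists>q p g'. g = q * f + fps_cutoff n p + fps_const fps_X * g'" for g :: "'a fps fps"
  proof -
    have "\<forall>i. \<exists>b. fps_nth (fps_cutoff n f) i = fps_X * b"
      using f by (auto simp: weierstrass_regular_def dvd_def)
    then obtain b where b: "\<And>i. fps_nth (fps_cutoff n f) i = fps_X * b i" by metis
    have c: "fps_cutoff n f = fps_const fps_X * Abs_fps b"
      by (rule fps_ext) (simp add: b[symmetric])
    have fs: "f = fps_cutoff n f + fps_X ^ n * u"
      unfolding u_def using fps_shift_cutoff'[of n f] by (simp add: add.commute)
    let ?q = "fps_shift n g * v"
    have "g = fps_X ^ n * fps_shift n g + fps_cutoff n g"
      using fps_shift_cutoff'[of n g] by simp
    also have "fps_X ^ n * fps_shift n g = ?q * (fps_X ^ n * u)"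
      using uv by (simp add: algebra_simps)
    also have "fps_X ^ n * u = f - fps_const fps_X * Abs_fps b"
      by (subst fs) (simp add: c)
    finally have "g = ?q * f + fps_cutoff n g + fps_const fps_X * (- (?q * Abs_fps b))"
      by (simp add: algebra_simps)
    then show ?thesis by blast
  qed
  then obtain Q P G where QPG:
      "\<And>g. g = Q g * f + fps_cutoff n (P g) + fps_const fps_X * G g" by metis
  define gs where "gs k = (G ^^ k) g" for k
  have tele: "g = (\<Sum>k<m. fps_const (fps_X ^ k) * Q (gs k)) * f +
      (\<Sum>k<m. fps_const (fps_X ^ k) * fps_cutoff n (P (gs k))) + fps_const (fps_X ^ m) * gs m" for m
  proof (induction m)
    case 0
    show ?case by (simp add: gs_def)
  next
    case (Suc m)
    have "fps_const (fps_X ^ m) * gs m = fps_const (fps_X ^ m) *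
        (Q (gs m) * f + fps_cutoff n (P (gs m)) + fps_const fps_X * gs (Suc m))"
      using QPG[of "gs m"] by (simp add: gs_def)
    also have "\<dots> = fps_const (fps_X ^ m) * Q (gs m) * f +
        fps_const (fps_X ^ m) * fps_cutoff n (P (gs m)) + fps_const (fps_X ^ Suc m) * gs (Suc m)"
      by (simp only: power_Suc2 fps_const_mult[symmetric]) (simp add: algebra_simps)
    finally show ?case
      by (subst Suc.IH) (simp add: algebra_simps)
  qed
  obtain q where q: "\<And>m i. fps_X ^ m dvd
      fps_nth (q - (\<Sum>k<m. fps_const (fps_X ^ k) * Q (gs k))) i"
    using coefficientwise_fps_X_adic_sum_exists[of "\<lambda>k. Q (gs k)"] by blast
  obtain p where p: "\<And>m i. fps_X ^ m dvd
      fps_nth (p - (\<Sum>k<m. fps_const (fps_X ^ k) * fps_cutoff n (P (gs k)))) i"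
    using coefficientwise_fps_X_adic_sum_exists[of "\<lambda>k. fps_cutoff n (P (gs k))"] by blast
  have p0: "fps_nth p i = 0" if "i \<ge> n" for i
    using p[of _ i] that by (intro fps_eq_0_if_fps_X_powers_dvd) (simp add: fps_sum_nth)
  have "fps_nth (g - (q * f + p)) i = 0" for i
  proof (rule fps_eq_0_if_fps_X_powers_dvd)
    fix m
    define q' p' where "q' = q - (\<Sum>k<m. fps_const (fps_X ^ k) * Q (gs k))"
      and "p' = p - (\<Sum>k<m. fps_const (fps_X ^ k) * fps_cutoff n (P (gs k)))"
    have "g - (q * f + p) = fps_const (fps_X ^ m) * gs m - q' * f - p'"
      by (subst tele[of m]) (simp add: q'_def p'_def algebra_simps)
    moreover have "fps_X ^ m dvd fps_nth (q' * f) i"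
      unfolding fps_mult_nth using q[of m] by (auto intro!: dvd_sum dvd_mult2 simp: q'_def)
    moreover have "fps_X ^ m dvd fps_nth p' i"
      using p by (simp add: p'_def)
    ultimately show "fps_X ^ m dvd fps_nth (g - (q * f + p)) i"
      by simp
  qed
  then have "g = q * f + p"
    by (metis (no_types) eq_iff_diff_eq_0 fps_ext fps_zero_nth)
  moreover have "p = fps_of_poly (truncate_fps n p)"
    by (rule fps_ext) (use p0 in auto)
  ultimately show ?thesis
    by (intro exI[of _ q] exI[of _ "truncate_fps n p"]) (auto simp: coeff_truncate_fps)
qed

definition distinguished :: "'a::comm_ring_1 fps poly \<Rightarrow> bool" where
  "distinguished w \<longleftrightarrow> lead_coeff w = 1 \<and> (\<forall>i<Polynomial.degree w. fps_X dvd poly.coeff w i)"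

lemma distinguished_regular:
  "distinguished w \<Longrightarrow> weierstrass_regular (Polynomial.degree w) (fps_of_poly w)"
  by (auto simp: distinguished_def weierstrass_regular_def)

text \<open>The polynomial is the difference of \<open>Y\<^sup>n\<close> and its remainder on division by \<open>f\<close>. The
  quotient is a unit, since this difference and \<open>f\<close> both have order \<open>n\<close> modulo \<open>X\<close>.\<close>

lemma weierstrass_preparation:
  fixes f :: "'a::field fps fps"
  assumes f: "weierstrass_regular n f"
  shows "\<exists>w u. distinguished w \<and> Polynomial.degree w = n \<and> u dvd 1 \<and> f = u * fps_of_poly w"
proof -
  obtain q p where qp: "fps_X ^ n = q * f + fps_of_poly p" and p: "\<forall>i\<ge>n. poly.coeff p i = 0"
    using weierstrass_division[OF f] by blast
  define w where "w = monom 1 n - p"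
  have qf: "q * f = fps_of_poly w"
    using qp by (simp add: w_def fps_of_poly_diff fps_of_poly_monom' algebra_simps)
  have wn: "poly.coeff w n = 1" using p by (simp add: w_def)
  have deg: "Polynomial.degree w = n"
    by (rule antisym) (auto intro!: degree_le le_degree simp: wn, auto simp: w_def p)
  have low: "fps_X dvd poly.coeff w i" if "i < n" for i
  proof -
    have "fps_X dvd fps_nth (q * f) i"
      unfolding fps_mult_nth using f that
      by (intro dvd_sum dvd_mult) (auto simp: weierstrass_regular_def)
    then show ?thesis by (simp add: qf)
  qed
  have "\<not> fps_X dvd fps_nth q 0"
  proof
    assume *: "fps_X dvd fps_nth q 0"
    have "fps_X dvd fps_nth (q * f) n"
      unfolding fps_mult_nth
    proof (rule dvd_sum)
      fix i assume "i \<in> {0..n}"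
      then show "fps_X dvd fps_nth q i * fps_nth f (n - i)"
        using * f by (cases "i = 0") (auto simp: weierstrass_regular_def)
    qed
    then show False by (simp add: qf wn fps_X_dvd_iff)
  qed
  then have "fps_nth q 0 dvd 1" by (simp add: fps_X_dvd_iff)
  then have "q dvd 1" by (rule fps_dvd_1_if_nth_0_dvd_1)
  then obtain u where u: "1 = q * u" by (elim dvdE)
  then have "f = u * fps_of_poly w"
    unfolding qf[symmetric] by (metis mult.assoc mult.commute mult_1_left)
  moreover have "u dvd 1" using u by (metis dvd_triv_right)
  moreover have "distinguished w"
    using wn deg low by (simp add: distinguished_def)
  ultimately show ?thesis using deg by blast
qed

text \<open>Pseudo-division multiplies the dividend by a power of the leading coefficient, which is 1.\<close>

lemma monic_division:
  fixes w p :: "'a::idom poly"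
  assumes "lead_coeff w = 1"
  shows "\<exists>q r. p = w * q + r \<and> (r = 0 \<or> Polynomial.degree r < Polynomial.degree w)"
proof -
  obtain q r where qr: "pseudo_divmod p w = (q, r)" by (cases "pseudo_divmod p w") auto
  have "w \<noteq> 0" using assms by auto
  from pseudo_divmod[OF this qr] show ?thesis using assms by auto
qed

text \<open>Division with remainder by \<open>w\<close> in \<open>A[Y]\<close> is a Weierstrass division in \<open>A[[Y]]\<close>. As the
  quotient is unique, divisibility by \<open>w\<close> descends from power series to polynomials.\<close>

lemma fps_of_poly_dvd_distinguished:
  fixes w p :: "'a::field fps poly"
  assumes w: "distinguished w" and qp: "fps_of_poly p = q * fps_of_poly w"
  shows "\<exists>s. q = fps_of_poly s \<and> p = s * w"
proof -
  obtain s r where sr: "p = w * s + r" and r: "r = 0 \<or> Polynomial.degree r < Polynomial.degree w"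
    using monic_division[of w p] w by (auto simp: distinguished_def)
  have "(q - fps_of_poly s) * fps_of_poly w = fps_of_poly r"
    using qp by (simp add: sr fps_of_poly_add fps_of_poly_mult algebra_simps)
  then have q: "q - fps_of_poly s = 0"
    using r by (intro weierstrass_quotient_unique[OF distinguished_regular[OF w]])
      (auto intro: coeff_eq_0)
  then have "p = s * w"
    using qp by (simp add: fps_of_poly_mult[symmetric])
  then show ?thesis using q by auto
qed

text \<open>Hensel's lemma for the factorization of \<open>p\<close> modulo \<open>X\<close> into a power of the indeterminate and
  a polynomial that does not vanish at 0. It is Weierstrass preparation for \<open>p\<close> as a power series.\<close>

lemma hensel_factorization:
  fixes p :: "'a::field fps poly"
  assumes "\<not> fps_X dvd poly.coeff p i"
  shows "\<exists>w s. distinguished w \<and> p = s * w \<and> \<not> fps_X dvd poly.coeff s 0"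
proof -
  define n where "n = (LEAST i. \<not> fps_X dvd poly.coeff p i)"
  have "\<not> fps_X dvd poly.coeff p n" unfolding n_def by (rule LeastI) (fact assms)
  moreover have "fps_X dvd poly.coeff p i" if "i < n" for i
    using not_less_Least that unfolding n_def by blast
  ultimately have "weierstrass_regular n (fps_of_poly p)"
    by (simp add: weierstrass_regular_def fps_X_dvd_iff)
  then obtain w u where w: "distinguished w" and u: "u dvd 1" "fps_of_poly p = u * fps_of_poly w"
    using weierstrass_preparation by blast
  obtain s where s: "u = fps_of_poly s" "p = s * w"
    using fps_of_poly_dvd_distinguished[OF w u(2)] by blast
  obtain v where "u * v = 1" using u(1) by (metis dvdE)
  then have "fps_nth u 0 * fps_nth v 0 = 1" by (metis fps_mult_nth_0 fps_one_nth)
  then have "fps_nth u 0 dvd 1" by (metis dvdI)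
  then have "\<not> fps_X dvd poly.coeff s 0"
    by (simp add: s(1) fps_X_dvd_iff)
  then show ?thesis using w s(2) by blast
qed


section \<open>The integral closure of a branch\<close>

text \<open>Since every nonzero series is a unit times a power of \<open>X\<close>, such a homomorphism into a field is
  injective; its image generates a copy of \<open>K((X))\<close>.\<close>

locale power_series_hom =
  fixes \<psi> :: "'k::field fps \<Rightarrow> 'o::field"
  assumes hom_0: "\<psi> 0 = 0" and hom_1: "\<psi> 1 = 1"
    and hom_add: "\<psi> (a + b) = \<psi> a + \<psi> b" and hom_mult: "\<psi> (a * b) = \<psi> a * \<psi> b"
    and hom_X_nz: "\<psi> fps_X \<noteq> 0"
begin

abbreviation x :: 'o where "x \<equiv> \<psi> fps_X"

definition ev :: "'k fps poly \<Rightarrow> 'o \<Rightarrow> 'o" where "ev p z = poly (map_poly \<psi> p) z"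

lemma hom_uminus: "\<psi> (- a) = - \<psi> a"
  using hom_add[of "-a" a] hom_0 by (simp add: eq_neg_iff_add_eq_0)

lemma hom_power: "\<psi> (a ^ k) = \<psi> a ^ k"
  by (induction k) (auto simp: hom_1 hom_mult)

lemma hom_unit_nz: "fps_nth u 0 \<noteq> 0 \<Longrightarrow> \<psi> u \<noteq> 0"
  using inverse_mult_eq_1[of u] hom_mult[of "inverse u" u] hom_1 by auto

lemma hom_unit_inverse: "fps_nth u 0 \<noteq> 0 \<Longrightarrow> \<psi> (inverse u) = inverse (\<psi> u)"
  using inverse_mult_eq_1[of u] hom_mult[of "inverse u" u] hom_1
  by (metis inverse_unique mult.commute)

lemma hom_decompose:
  assumes "a \<noteq> 0"
  obtains k u where "fps_nth u 0 \<noteq> 0" "\<psi> a = \<psi> u * x ^ k"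
  using fps_unit_factor_nth_0[OF assms] fps_unit_factor_decompose[of a] hom_mult hom_power
  by metis

lemma hom_nz: "a \<noteq> 0 \<Longrightarrow> \<psi> a \<noteq> 0"
  by (metis hom_decompose hom_unit_nz hom_X_nz mult_eq_0_iff power_not_zero)

lemma ev_0 [simp]: "ev 0 z = 0" by (simp add: ev_def)

lemma ev_pCons [simp]: "ev (pCons a p) z = \<psi> a + z * ev p z"
  by (simp add: ev_def map_poly_pCons hom_0)

lemma ev_add: "ev (p + q) z = ev p z + ev q z"
  by (induction p q rule: poly_induct2) (simp_all add: hom_add algebra_simps)

lemma ev_smult: "ev (smult a p) z = \<psi> a * ev p z"
  by (induction p) (simp_all add: hom_mult algebra_simps)

lemma ev_mult: "ev (p * q) z = ev p z * ev q z"
  by (induction p) (simp_all add: ev_add ev_smult algebra_simps hom_0)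

lemma ev_pcompose: "ev (pcompose p q) z = ev p (ev q z)"
  by (induction p) (simp_all add: pcompose_pCons ev_add ev_mult)

lemma ev_sum: "ev p z = (\<Sum>i\<le>Polynomial.degree p. \<psi> (poly.coeff p i) * z ^ i)"
  unfolding ev_def poly_altdef by (simp add: coeff_map_poly hom_0 hom_nz degree_map_poly)

lemma ev_reflect:
  assumes "z \<noteq> 0" "ev p z = 0"
  shows "ev (reflect_poly p) (inverse z) = 0"
proof -
  have "map_poly \<psi> (reflect_poly p) = reflect_poly (map_poly \<psi> p)"
    by (rule poly_eqI) (simp add: coeff_map_poly hom_0 coeff_reflect_poly degree_map_poly hom_nz)
  then show ?thesis
    using assms by (simp add: ev_def poly_reflect_poly_nz)
qed

lemma ev_monic_power:
  assumes "lead_coeff w = 1" "ev w z = 0"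
  shows "z ^ Polynomial.degree w = (\<Sum>i<Polynomial.degree w. \<psi> (- poly.coeff w i) * z ^ i)"
proof -
  have "ev w z = (\<Sum>i<Suc (Polynomial.degree w). \<psi> (poly.coeff w i) * z ^ i)"
    by (simp only: ev_sum lessThan_Suc_atMost)
  also have "\<dots> = z ^ Polynomial.degree w + (\<Sum>i<Polynomial.degree w. \<psi> (poly.coeff w i) * z ^ i)"
    by (simp only: sum.lessThan_Suc assms(1) hom_1 mult_1_left add.commute)
  finally show ?thesis
    by (simp only: assms(2) hom_uminus mult_minus_left sum_negf eq_neg_iff_add_eq_0)
qed

end

text \<open>The ring \<open>D\<close> plays the role of \<open>K[[X\<^sub>1,X\<^sub>2]]/\<langle>f\<rangle>\<close> for an irreducible \<open>f\<close>. Below, \<open>L\<close> is its field of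
  fractions and \<open>V\<close> its integral closure. The bound \<open>n\<close> on the degrees is uniform, which is what
  makes \<open>V\<close> discrete.\<close>

locale curve_model = power_series_hom \<psi> for \<psi> :: "'k::field fps \<Rightarrow> 'o::field" +
  fixes D :: "'o set" and n :: nat
  assumes D_hom: "\<psi> a \<in> D"
    and D_add: "c \<in> D \<Longrightarrow> d \<in> D \<Longrightarrow> c + d \<in> D"
    and D_mult: "c \<in> D \<Longrightarrow> d \<in> D \<Longrightarrow> c * d \<in> D"
    and inverse_parameter_notin: "inverse x \<notin> D"
    and D_algebraic: "d \<in> D \<Longrightarrow> \<exists>p. p \<noteq> 0 \<and> Polynomial.degree p \<le> n \<and> ev p d = 0"
begin

definition L :: "'o set" where "L = {a / b | a b. a \<in> D \<and> b \<in> D \<and> b \<noteq> 0}"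

definition integral :: "'o \<Rightarrow> bool" where
  "integral z \<longleftrightarrow> (\<exists>m c. (\<forall>i<m. c i \<in> D) \<and> z ^ m = (\<Sum>i<m. c i * z ^ i))"

definition V :: "'o set" where "V = {z \<in> L. integral z}"

text \<open>The powers of such an element have a common denominator. Sums and products inherit this
  property, so that it gives the ring structure of \<open>V\<close> without determinants or finite modules.\<close>

definition power_bounded :: "'o \<Rightarrow> bool" where
  "power_bounded z \<longleftrightarrow> (\<exists>N. \<forall>k. x ^ N * z ^ k \<in> D)"

lemma D_0: "0 \<in> D" and D_1: "1 \<in> D"
  using D_hom[of 0] D_hom[of 1] hom_0 hom_1 by auto

lemma D_uminus: "c \<in> D \<Longrightarrow> - c \<in> D"
  using D_mult[OF D_hom[of "-1"], of c] by (simp add: hom_uminus hom_1)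

lemma D_power: "c \<in> D \<Longrightarrow> c ^ k \<in> D"
  by (induction k) (auto intro: D_1 D_mult)

lemma D_sum: "(\<And>i. i \<in> I \<Longrightarrow> f i \<in> D) \<Longrightarrow> sum f I \<in> D"
  by (induction I rule: infinite_finite_induct) (auto intro: D_0 D_add)

lemma D_of_nat: "of_nat k \<in> D"
  by (induction k) (auto intro: D_0 D_1 D_add)

lemma x_power_D: "x ^ k \<in> D"
  by (intro D_power D_hom)

lemma ev_in_D: "z \<in> D \<Longrightarrow> ev p z \<in> D"
  by (induction p) (auto intro: D_0 D_add D_mult D_hom)

lemma monic_root_integral:
  assumes "lead_coeff w = 1" "ev w z = 0"
  shows "integral z"
  unfolding integral_def
  by (intro exI[of _ "Polynomial.degree w"] exI[of _ "\<lambda>i. \<psi> (- poly.coeff w i)"] conjI allI impI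
      D_hom ev_monic_power assms)

text \<open>In an equation of \<open>b\<close> over \<open>K[[X]]\<close> with nonzero constant coefficient, this coefficient is a
  multiple of \<open>b\<close>, and it is a unit times a power of \<open>X\<close>.\<close>

lemma D_nonzero_dvd_power:
  assumes b: "b \<in> D" "b \<noteq> 0"
  shows "\<exists>d\<in>D. \<exists>N. b * d = x ^ N"
proof -
  have "\<exists>d\<in>D. \<exists>N. b * d = x ^ N" if "p \<noteq> 0" "ev p b = 0" for p
    using that
  proof (induction p)
    case (pCons a p)
    show ?case
    proof (cases "a = 0")
      case True
      then show ?thesis using pCons b by (auto simp: hom_0)
    next
      case False
      then obtain k u where u: "fps_nth u 0 \<noteq> 0" "\<psi> a = \<psi> u * x ^ k"
        using hom_decompose by blast
      have "b * ev p b = - (\<psi> u * x ^ k)" using pCons.prems(2) u(2)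
        by (simp add: eq_neg_iff_add_eq_0 add.commute)
      then have "b * (- (\<psi> (inverse u) * ev p b)) = x ^ k"
        using hom_unit_nz[OF u(1)] by (simp add: hom_unit_inverse[OF u(1)] field_simps)
      moreover have "- (\<psi> (inverse u) * ev p b) \<in> D"
        by (intro D_uminus D_mult D_hom ev_in_D b)
      ultimately show ?thesis by blast
    qed
  qed simp
  then show ?thesis using D_algebraic[OF b(1)] by auto
qed

lemma L_denominator: "z \<in> L \<Longrightarrow> \<exists>N. x ^ N * z \<in> D"
proof -
  assume "z \<in> L"
  then obtain a b where ab: "a \<in> D" "b \<in> D" "b \<noteq> 0" "z = a / b"
    by (auto simp: L_def)
  obtain d N where d: "d \<in> D" "b * d = x ^ N"
    using D_nonzero_dvd_power ab by blast
  have "x ^ N * z = a * d" using d(2)[symmetric] ab by simp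
  then show ?thesis using d ab D_mult by metis
qed

lemma L_I: "x ^ N * z \<in> D \<Longrightarrow> z \<in> L"
proof -
  assume *: "x ^ N * z \<in> D"
  have "z = (x ^ N * z) / x ^ N" using hom_X_nz by simp
  then show "z \<in> L" using * x_power_D hom_X_nz unfolding L_def by fastforce
qed

lemma D_L: "d \<in> D \<Longrightarrow> d \<in> L"
  using L_I[of 0 d] by simp

lemma L_divide: "a \<in> L \<Longrightarrow> b \<in> L \<Longrightarrow> a / b \<in> L"
proof -
  assume "a \<in> L" "b \<in> L"
  then obtain p q r s where "a = p / q" "b = r / s"
    and D: "p \<in> D" "q \<in> D" "r \<in> D" "s \<in> D" "q \<noteq> 0" "s \<noteq> 0"
    by (auto simp: L_def)
  then have "a / b = (p * s) / (q * r)" "b = r / s" by simp_all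
  show "a / b \<in> L"
  proof (cases "r = 0")
    case True
    then show ?thesis using \<open>b = r / s\<close> D_L[OF D_0] by simp
  next
    case False
    then have "p * s \<in> D" "q * r \<in> D" "q * r \<noteq> 0" using D D_mult by auto
    then show ?thesis unfolding \<open>a / b = _\<close> L_def by blast
  qed
qed

lemma L_mult: "a \<in> L \<Longrightarrow> b \<in> L \<Longrightarrow> a * b \<in> L"
  using L_divide[of a "1 / b"] L_divide[of 1 b] D_L[OF D_1] by simp

lemma L_inverse: "a \<in> L \<Longrightarrow> inverse a \<in> L"
  using L_divide[of 1 a] D_L[OF D_1] by (simp add: divide_inverse)

lemma L_add: "a \<in> L \<Longrightarrow> b \<in> L \<Longrightarrow> a + b \<in> L"
proof -
  assume "a \<in> L" "b \<in> L"
  then obtain p q r s where "a = p / q" "b = r / s"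
    and D: "p \<in> D" "q \<in> D" "r \<in> D" "s \<in> D" "q \<noteq> 0" "s \<noteq> 0"
    by (auto simp: L_def)
  then have "a + b = (p * s + r * q) / (q * s)" by (simp add: field_simps)
  moreover have "p * s + r * q \<in> D" "q * s \<in> D" "q * s \<noteq> 0"
    using D by (auto intro: D_add D_mult)
  ultimately show "a + b \<in> L" unfolding L_def by blast
qed

lemma L_power: "a \<in> L \<Longrightarrow> a ^ k \<in> L"
  by (induction k) (auto intro: L_mult D_L D_1)

text \<open>A multiple \<open>x\<^sup>N z\<close> is in \<open>D\<close>, and substituting \<open>X\<^sup>N T\<close> for the indeterminate \<open>T\<close> does not change
  degrees. Division by the content leaves a coefficient that is nonzero modulo \<open>X\<close>.\<close>

lemma L_algebraic:
  assumes "z \<in> L"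
  shows "\<exists>p i. Polynomial.degree p \<le> n \<and> ev p z = 0 \<and> \<not> fps_X dvd poly.coeff p i"
proof -
  obtain N where N: "x ^ N * z \<in> D" using L_denominator assms by blast
  then obtain p where p: "p \<noteq> 0" "Polynomial.degree p \<le> n" "ev p (x ^ N * z) = 0"
    using D_algebraic by blast
  define q where "q = pcompose p [:0, fps_X ^ N:]"
  have q: "q \<noteq> 0" "Polynomial.degree q \<le> n" "ev q z = 0"
    using p by (auto simp: q_def pcompose_eq_0_iff degree_pcompose ev_pcompose hom_0 hom_power mult.commute)
  have "\<psi> (content q) * ev (primitive_part q) z = 0"
    using q(3) by (simp flip: ev_smult)
  then have "ev (primitive_part q) z = 0"
    using hom_nz[of "content q"] q(1) by simp
  moreover have "\<exists>i. \<not> fps_X dvd poly.coeff (primitive_part q) i"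
  proof (rule ccontr)
    assume "\<nexists>i. \<not> fps_X dvd poly.coeff (primitive_part q) i"
    then have "fps_X dvd content (primitive_part q)"
      by (subst const_poly_dvd_iff_dvd_content[symmetric], subst const_poly_dvd_iff) auto
    then show False using q(1) by (simp add: content_primitive_part del: fps_is_unit_iff) 
      (simp add: fps_X_dvd_iff)
  qed
  ultimately show ?thesis using q(2) by (metis degree_primitive_part)
qed

text \<open>Hensel's lemma is used twice. If \<open>z\<close> is not a root of the distinguished factor of its equation,
  then it is a root of the other factor \<open>s\<close>, whose constant coefficient is a unit; so \<open>1/z\<close> is a root
  of the reversed polynomial, which has a unit as leading coefficient. If \<open>1/z\<close> is not a root of the
  distinguished factor of the latter, then it is a root of a polynomial whose constant coefficient is a
  unit, and reversing this one makes \<open>z\<close> integral.\<close>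

lemma integral_or_inverse_distinguished_root:
  assumes z: "z \<in> L" "z \<noteq> 0"
  shows "integral z \<or> (\<exists>w. distinguished w \<and> ev w (inverse z) = 0)"
proof -
  obtain p i where p: "ev p z = 0" "\<not> fps_X dvd poly.coeff p i"
    using L_algebraic[OF z(1)] by blast
  obtain w s where w: "distinguished w" "p = s * w" "\<not> fps_X dvd poly.coeff s 0"
    using hensel_factorization[OF p(2)] by blast
  show ?thesis
  proof (cases "ev w z = 0")
    case True
    then show ?thesis using monic_root_integral w(1) by (auto simp: distinguished_def)
  next
    case False
    then have "ev s z = 0" using p(1) w(2) by (simp add: ev_mult)
    then have r0: "ev (reflect_poly s) (inverse z) = 0" using ev_reflect z by blast
    have s0: "poly.coeff s 0 \<noteq> 0" using w(3) by auto
    have lr: "lead_coeff (reflect_poly s) = poly.coeff s 0"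
      using s0 by (simp add: coeff_reflect_poly)
    then obtain w' s' where w': "distinguished w'" "reflect_poly s = s' * w'"
      "\<not> fps_X dvd poly.coeff s' 0"
      using hensel_factorization[of "reflect_poly s" "Polynomial.degree (reflect_poly s)"] w(3) by auto
    show ?thesis
    proof (cases "ev w' (inverse z) = 0")
      case True
      then show ?thesis using w'(1) by blast
    next
      case False
      then have "ev s' (inverse z) = 0" using r0 w'(2) by (simp add: ev_mult)
      then have e: "ev (reflect_poly s') z = 0"
        using ev_reflect[of "inverse z" s'] z by simp
      have "poly.coeff s' 0 \<noteq> 0" using w'(3) by auto
      then have "lead_coeff (reflect_poly s') = poly.coeff s' 0"
        by (simp add: coeff_reflect_poly)
      then have u: "fps_nth (lead_coeff (reflect_poly s')) 0 \<noteq> 0"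
        using w'(3) by (simp add: fps_X_dvd_iff)
      define t where "t = smult (inverse (lead_coeff (reflect_poly s'))) (reflect_poly s')"
      have "ev t z = 0" using e by (simp add: t_def ev_smult)
      moreover have "lead_coeff t = 1"
        unfolding t_def lead_coeff_smult using inverse_mult_eq_1[OF u] .
      ultimately show ?thesis using monic_root_integral by blast
    qed
  qed
qed

text \<open>All powers of \<open>z\<close> are combinations of \<open>1, z, \<dots>, z\<^bsup>m-1\<^esup>\<close> with coefficients in \<open>D\<close>, where
  \<open>m\<close> is the degree of an integral equation of \<open>z\<close>.\<close>

lemma integral_power_bounded:
  assumes z: "z \<in> L" "integral z"
  shows "power_bounded z"
proof -
  obtain m c where c: "\<And>i. i < m \<Longrightarrow> c i \<in> D" "z ^ m = (\<Sum>i<m. c i * z ^ i)"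
    using z(2) by (auto simp: integral_def)
  have "\<forall>i. \<exists>N. x ^ N * z ^ i \<in> D" using L_denominator L_power z(1) by blast
  then obtain N where N: "\<And>i. x ^ N i * z ^ i \<in> D" by metis
  define M where "M = (\<Sum>i<m. N i)"
  have "x ^ M * z ^ k \<in> D" for k
  proof (induction k rule: less_induct)
    case (less k)
    show ?case
    proof (cases "k < m")
      case True
      then have "N k \<le> M" unfolding M_def by (intro member_le_sum) auto
      then obtain K where "M = K + N k" by (metis le_add_diff_inverse2)
      then have "x ^ M * z ^ k = x ^ K * (x ^ N k * z ^ k)"
        by (simp add: power_add mult.assoc)
      then show ?thesis using D_mult[OF x_power_D N, of K k] by metis
    next
      case False
      have "z ^ k = z ^ m * z ^ (k - m)" using False by (simp flip: power_add)
      then have "x ^ M * z ^ k = (\<Sum>i<m. c i * (x ^ M * z ^ (i + (k - m))))"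
        by (simp add: c(2) sum_distrib_left sum_distrib_right power_add algebra_simps)
      also have "\<dots> \<in> D"
        using False by (intro D_sum D_mult c less.IH) auto
      finally show ?thesis .
    qed
  qed
  then show ?thesis by (auto simp: power_bounded_def)
qed

lemma power_bounded_D: "d \<in> D \<Longrightarrow> power_bounded d"
  unfolding power_bounded_def by (intro exI[of _ 0]) (simp add: D_power)

lemma power_bounded_mult:
  assumes "power_bounded a" "power_bounded b"
  shows "power_bounded (a * b)"
proof -
  obtain M N where "\<And>k. x ^ M * a ^ k \<in> D" "\<And>k. x ^ N * b ^ k \<in> D"
    using assms by (auto simp: power_bounded_def)
  then have "x ^ (M + N) * (a * b) ^ k \<in> D" for k
    using D_mult[of "x ^ M * a ^ k" "x ^ N * b ^ k"]
    by (simp add: power_add power_mult_distrib mult.assoc mult.left_commute)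
  then show ?thesis by (auto simp: power_bounded_def)
qed

lemma power_bounded_add:
  assumes "power_bounded a" "power_bounded b"
  shows "power_bounded (a + b)"
proof -
  obtain M N where MN: "\<And>k. x ^ M * a ^ k \<in> D" "\<And>k. x ^ N * b ^ k \<in> D"
    using assms by (auto simp: power_bounded_def)
  have "x ^ (M + N) * (a + b) ^ k \<in> D" for k
  proof -
    have "x ^ (M + N) * (a + b) ^ k =
        (\<Sum>i\<le>k. of_nat (k choose i) * ((x ^ M * a ^ i) * (x ^ N * b ^ (k - i))))"
      by (simp add: binomial_ring sum_distrib_left power_add algebra_simps)
    also have "\<dots> \<in> D" by (intro D_sum D_mult D_of_nat MN)
    finally show ?thesis .
  qed
  then show ?thesis by (auto simp: power_bounded_def)
qed

lemma power_bounded_power: "power_bounded a \<Longrightarrow> power_bounded (a ^ k)"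
  by (induction k) (auto intro: power_bounded_mult power_bounded_D D_1)

lemma power_bounded_sum: "(\<And>i. i \<in> I \<Longrightarrow> power_bounded (f i)) \<Longrightarrow> power_bounded (sum f I)"
  by (induction I rule: infinite_finite_induct) (auto intro: power_bounded_D D_0 power_bounded_add)

lemma not_power_bounded_inverse_x: "\<not> power_bounded (inverse x)"
proof
  assume "power_bounded (inverse x)"
  then obtain N where "\<And>k. x ^ N * inverse x ^ k \<in> D" by (auto simp: power_bounded_def)
  then have "x ^ N * inverse x ^ Suc N \<in> D" by blast
  moreover have "x ^ N * inverse x ^ Suc N = inverse x"
    using hom_X_nz by (simp add: field_simps)
  ultimately show False using inverse_parameter_notin by metis
qed

text \<open>The equation of \<open>y\<close> reduces to \<open>y\<^sup>d = 0\<close> modulo \<open>X\<close>.\<close>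

lemma distinguished_root_power:
  assumes w: "distinguished w" "ev w y = 0" and y: "power_bounded y"
  shows "\<exists>e. power_bounded e \<and> y ^ Polynomial.degree w = x * e"
proof -
  have "\<forall>i<Polynomial.degree w. \<exists>b. poly.coeff w i = fps_X * b"
    using w by (auto simp: distinguished_def dvd_def)
  then obtain b where b: "\<And>i. i < Polynomial.degree w \<Longrightarrow> poly.coeff w i = fps_X * b i" by metis
  have "y ^ Polynomial.degree w = x * (\<Sum>i<Polynomial.degree w. - \<psi> (b i) * y ^ i)"
    using w by (subst ev_monic_power)
      (auto simp: distinguished_def b hom_mult hom_uminus sum_distrib_left intro!: sum.cong)
  moreover have "power_bounded (\<Sum>i<Polynomial.degree w. - \<psi> (b i) * y ^ i)"
    by (intro power_bounded_sum power_bounded_mult power_bounded_power y power_bounded_D D_uminus D_hom)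
  ultimately show ?thesis by blast
qed

text \<open>If \<open>z\<close> is not integral, then \<open>1/z\<close> has a power \<open>x e\<close> with \<open>e\<close> power-bounded, and \<open>1/x\<close> is the
  product of \<open>e\<close> and a power of \<open>z\<close>. So if \<open>z\<close> were power-bounded, then so would be \<open>1/x\<close>, and
  \<open>1/x\<close> would be in \<open>D\<close>.\<close>

lemma integral_iff_power_bounded:
  assumes z: "z \<in> L"
  shows "integral z \<longleftrightarrow> power_bounded z"
proof
  assume pb: "power_bounded z"
  show "integral z"
  proof (cases "z = 0")
    case True
    then show ?thesis unfolding integral_def
      by (intro exI[of _ 1] exI[of _ "\<lambda>_. 0"]) (auto simp: D_0)
  next
    case False
    show ?thesis
    proof (rule ccontr)
      assume "\<not> integral z"
      then obtain w where w: "distinguished w" "ev w (inverse z) = 0"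
        using integral_or_inverse_distinguished_root[OF z False] by blast
      have "power_bounded (inverse z)"
        using monic_root_integral w by (intro integral_power_bounded L_inverse z) (auto simp: distinguished_def)
      then obtain e where e: "power_bounded e" "inverse z ^ Polynomial.degree w = x * e"
        using distinguished_root_power w by blast
      have "1 = z ^ Polynomial.degree w * inverse z ^ Polynomial.degree w"
        using False by (simp flip: power_mult_distrib)
      then have "1 = x * (z ^ Polynomial.degree w * e)" using e(2) by (simp add: ac_simps)
      then have "inverse x = z ^ Polynomial.degree w * e" by (metis inverse_unique)
      then have "power_bounded (inverse x)"
        by (simp only:) (intro power_bounded_mult power_bounded_power pb e)
      then show False using not_power_bounded_inverse_x by blast
    qed
  qed
qed (use integral_power_bounded z in blast)

lemma V_iff: "z \<in> V \<longleftrightarrow> z \<in> L \<and> power_bounded z"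
  using integral_iff_power_bounded by (auto simp: V_def)

lemma D_V: "d \<in> D \<Longrightarrow> d \<in> V"
  by (simp add: V_iff D_L power_bounded_D)

lemma V_add: "a \<in> V \<Longrightarrow> b \<in> V \<Longrightarrow> a + b \<in> V"
  by (simp add: V_iff L_add power_bounded_add)

lemma V_mult: "a \<in> V \<Longrightarrow> b \<in> V \<Longrightarrow> a * b \<in> V"
  by (simp add: V_iff L_mult power_bounded_mult)

lemma V_0: "0 \<in> V" and V_1: "1 \<in> V" and V_x: "x \<in> V"
  by (simp_all add: D_V D_0 D_1 D_hom)

lemma V_uminus: "a \<in> V \<Longrightarrow> - a \<in> V"
  using V_mult[OF D_V[OF D_uminus[OF D_1]]] by simp

lemma V_power: "a \<in> V \<Longrightarrow> a ^ k \<in> V"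
  by (induction k) (auto intro: V_1 V_mult)

text \<open>Distinguished polynomials are monic. So \<open>V\<close> is a valuation ring of \<open>L\<close>.\<close>

lemma V_or_inverse:
  assumes "z \<in> L"
  shows "z \<in> V \<or> inverse z \<in> V"
proof (cases "z = 0")
  case False
  then have "integral z \<or> integral (inverse z)"
    using integral_or_inverse_distinguished_root[OF assms False] monic_root_integral
    unfolding distinguished_def by blast
  then show ?thesis
    using assms L_inverse[OF assms] by (auto simp: V_def)
qed (simp add: V_0)

text \<open>Multiply an integral equation of \<open>1/d\<close> of degree \<open>m\<close> by \<open>d\<^bsup>m-1\<^esup>\<close>.\<close>

lemma inverse_in_D_if_in_V:
  assumes d: "d \<in> D" "inverse d \<in> V"
  shows "inverse d \<in> D"
proof (cases "d = 0")
  case False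
  obtain m c where c: "\<And>i. i < m \<Longrightarrow> c i \<in> D" "inverse d ^ m = (\<Sum>i<m. c i * inverse d ^ i)"
    using d(2) by (auto simp: V_def integral_def)
  show ?thesis
  proof (cases m)
    case 0
    then show ?thesis using c(2) by simp
  next
    case (Suc l)
    have inv: "inverse d ^ i * d ^ i = 1" for i
      using False power_mult_distrib[of "inverse d" d i] by simp
    have "inverse d = inverse d ^ m * d ^ l"
      using inv[of l] unfolding Suc power_Suc mult.assoc by (simp only: mult_1_right)
    also have "\<dots> = (\<Sum>i<m. c i * (inverse d ^ i * d ^ l))"
      unfolding c(2) sum_distrib_right mult.assoc ..
    also have "\<dots> = (\<Sum>i<m. c i * d ^ (l - i))"
    proof (rule sum.cong)
      fix i assume "i \<in> {..<m}"
      then have "l = i + (l - i)" using Suc by simp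
      then have "inverse d ^ i * d ^ l = (inverse d ^ i * d ^ i) * d ^ (l - i)"
        by (metis mult.assoc power_add)
      then show "c i * (inverse d ^ i * d ^ l) = c i * d ^ (l - i)"
        by (simp only: inv mult_1_left)
    qed simp
    also have "\<dots> \<in> D" by (intro D_sum D_mult D_power c d) auto
    finally show ?thesis .
  qed
qed (use d D_0 in simp)

text \<open>An equation of \<open>p\<close> of degree at most \<open>n\<close> splits by Hensel's lemma. If \<open>p\<close> is a root of the
  distinguished factor, of degree \<open>d\<close> say, then \<open>x\<close> divides \<open>p\<^sup>d\<close>, and \<open>p\<^sup>e\<close> divides \<open>x\<close>; as \<open>p\<close> is
  not a unit, \<open>e \<le> d\<close>. It cannot be a root of the other factor, whose constant coefficient is a unit.\<close>

lemma ramification_bound: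
  assumes p: "p \<in> V" "inverse p \<notin> V" and e: "x = p ^ e * v" "v \<in> V"
  shows "e \<le> n"
proof (rule ccontr)
  assume "\<not> e \<le> n"
  have p0: "p \<noteq> 0" using p by auto
  obtain q i where q: "Polynomial.degree q \<le> n" "ev q p = 0" "\<not> fps_X dvd poly.coeff q i"
    using L_algebraic[of p] p(1) unfolding V_def by blast
  then obtain w s where w: "distinguished w" "q = s * w" "\<not> fps_X dvd poly.coeff s 0"
    using hensel_factorization by blast
  have nz: "s \<noteq> 0" "w \<noteq> 0" using w(1,3) by (auto simp: distinguished_def)
  show False
  proof (cases "ev w p = 0")
    case True
    then obtain t where t: "power_bounded t" "p ^ Polynomial.degree w = x * t"
      using distinguished_root_power w(1) p(1) by (auto simp: V_iff)
    define d where "d = Polynomial.degree w"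
    have de: "d < e"
      using q(1) nz w(2) \<open>\<not> e \<le> n\<close> by (simp add: degree_mult_eq d_def)
    have "p ^ d = p ^ d * (p ^ (e - d) * (v * t))"
    proof -
      have "p ^ e = p ^ d * p ^ (e - d)" using de by (simp flip: power_add)
      then show ?thesis using t(2) unfolding d_def[symmetric] e(1) by (metis mult.assoc)
    qed
    then have "1 = p ^ (e - d) * (v * t)" using p0 by simp
    also have "e - d = Suc (e - d - 1)" using de by simp
    finally have "1 = p * (p ^ (e - d - 1) * (v * t))" by (simp add: mult.assoc)
    then have i: "inverse p = p ^ (e - d - 1) * (v * t)" by (metis inverse_unique)
    have "power_bounded (inverse p)" unfolding i
      using p e t by (intro power_bounded_mult power_bounded_power) (auto simp: V_iff)
    then show False using p L_inverse by (auto simp: V_iff)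
  next
    case False
    then have s: "ev s p = 0" using q(2) w(2) by (simp add: ev_mult)
    obtain a r where ar: "s = pCons a r" by (cases s)
    have a: "fps_nth a 0 \<noteq> 0" using w(3) ar by (simp add: fps_X_dvd_iff)
    have "p * (\<psi> (- inverse a) * ev r p) = 1"
    proof -
      have "p * ev r p = - \<psi> a" using s ar by (simp add: eq_neg_iff_add_eq_0 add.commute)
      moreover have "p * (\<psi> (- inverse a) * ev r p) = \<psi> (- inverse a) * (p * ev r p)"
        by (rule mult.left_commute)
      ultimately show ?thesis
        using hom_unit_nz[OF a] by (simp add: hom_uminus hom_unit_inverse[OF a])
    qed
    then have "inverse p = \<psi> (- inverse a) * ev r p" by (metis inverse_unique)
    moreover have "ev r p \<in> V"
      by (induction r) (auto intro: V_0 V_add V_mult p D_V D_hom)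
    ultimately show False using p V_mult D_V[OF D_hom] by metis
  qed
qed

text \<open>Take a nonunit \<open>p\<close> whose power \<open>p\<^sup>e\<close> divides \<open>x\<close> with \<open>e\<close> as large as possible. Every nonunit is
  divisible by \<open>p\<close>, since otherwise \<open>p\<close> is divisible by the square of a nonunit \<open>s\<close>, and \<open>s\<^bsup>2e\<^esup>\<close>
  divides \<open>x\<close>. In particular \<open>x\<close> is \<open>p\<^sup>e\<close> times a unit. A nonzero \<open>z\<close> divides some power \<open>x\<^sup>N\<close>, so no
  power of \<open>p\<close> beyond \<open>p\<^bsup>eN\<^esup>\<close> divides \<open>z\<close>.\<close>

theorem uniformizer_exists:
  "\<exists>p\<in>V. p \<noteq> 0 \<and> inverse p \<notin> V \<and>
     (\<forall>z\<in>V. z \<noteq> 0 \<longrightarrow> (\<exists>u k. u \<in> V \<and> inverse u \<in> V \<and> z = u * p ^ k))"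
proof -
  define E where "E = {e. \<exists>p v. p \<in> V \<and> inverse p \<notin> V \<and> v \<in> V \<and> x = p ^ e * v}"
  have "inverse x \<notin> V" using not_power_bounded_inverse_x by (simp add: V_iff)
  then have "1 \<in> E" unfolding E_def using V_x V_1 by force
  moreover have "\<forall>e\<in>E. e \<le> n" unfolding E_def using ramification_bound by blast
  then have finE: "finite E" using finite_nat_set_iff_bounded_le by blast
  ultimately have E: "Max E \<in> E" using Max_in by blast
  define e where "e = Max E"
  have e: "e \<in> E" "\<And>k. k \<in> E \<Longrightarrow> k \<le> e" "e \<ge> 1"
    using E finE \<open>1 \<in> E\<close> by (auto simp: e_def)
  obtain p v where p: "p \<in> V" "inverse p \<notin> V" "v \<in> V" "x = p ^ e * v"
    using e(1) by (auto simp: E_def)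
  have p0: "p \<noteq> 0" using p by auto
  have maxp: "q / p \<in> V" if q: "q \<in> V" "inverse q \<notin> V" for q
  proof (rule ccontr)
    assume nq: "q / p \<notin> V"
    have q0: "q \<noteq> 0" using q by auto
    define r where "r = p / q"
    have "q / p \<in> L" using q p by (auto simp: V_def intro: L_divide)
    then have r: "r \<in> V" "inverse r \<notin> V"
      using V_or_inverse[of "q / p"] nq by (auto simp: r_def)
    have pqr: "p = q * r" using q0 by (simp add: r_def)
    \<comment> \<open>In a valuation ring, one of the factors q, r divides the other one; s is the smaller one.\<close>
    have "\<exists>s t. s \<in> V \<and> inverse s \<notin> V \<and> t \<in> V \<and> p = s ^ 2 * t"
    proof (cases "r / q \<in> V")
      case True
      have "p = q ^ 2 * (r / q)" using q0 pqr by (simp add: power2_eq_square)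
      then show ?thesis using True q by blast
    next
      case False
      have "r / q \<in> L" using q r by (auto simp: V_def intro: L_divide)
      then have "q / r \<in> V" using V_or_inverse[of "r / q"] False by auto
      moreover have "p = r ^ 2 * (q / r)"
        using p0 pqr by (auto simp: power2_eq_square)
      ultimately show ?thesis using r by blast
    qed
    then obtain s t where s: "s \<in> V" "inverse s \<notin> V" "t \<in> V" "p = s ^ 2 * t" by blast
    have "x = s ^ (2 * e) * (t ^ e * v)"
      using p(4) s(4) by (simp add: power_mult_distrib power_mult mult.assoc)
    then have "2 * e \<in> E" unfolding E_def using s p V_mult V_power by blast
    then show False using e by fastforce
  qed
  have v: "inverse v \<in> V"
  proof (rule ccontr)
    assume "inverse v \<notin> V"
    then have "v / p \<in> V" using maxp p by blast
    moreover have "x = p ^ Suc e * (v / p)" using p p0 by simp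
    ultimately have "Suc e \<in> E" unfolding E_def using p by blast
    then show False using e by fastforce
  qed
  have "\<exists>u k. u \<in> V \<and> inverse u \<in> V \<and> z = u * p ^ k" if z: "z \<in> V" "z \<noteq> 0" for z
  proof -
    obtain N where N: "x ^ N * inverse z \<in> V"
      using L_denominator L_inverse z D_V by (metis (no_types, lifting) V_iff)
    define S where "S = {k. z / p ^ k \<in> V}"
    have "k \<le> e * N" if "k \<in> S" for k
    proof (rule ccontr)
      assume k: "\<not> k \<le> e * N"
      have "(z / p ^ k) * (x ^ N * inverse z) \<in> V" using that N V_mult S_def by blast
      from V_mult[OF V_mult[OF this V_power[OF v, of N]] V_power[OF p(1), of "k - e * N - 1"]]
      have "(z / p ^ k) * (x ^ N * inverse z) * inverse v ^ N * p ^ (k - e * N - 1) \<in> V" .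
      moreover have "(z / p ^ k) * (x ^ N * inverse z) * inverse v ^ N * p ^ (k - e * N - 1) = inverse p"
      proof -
        have v0: "v \<noteq> 0" using p hom_X_nz by auto
        have "k = e * N + Suc (k - e * N - 1)" using k by simp
        then have pk: "p ^ k = p ^ (e * N) * (p * p ^ (k - e * N - 1))"
          by (metis power_Suc power_add)
        have "x ^ N = p ^ (e * N) * v ^ N"
          using p(4) by (simp add: power_mult_distrib power_mult)
        then show ?thesis using z v0 p0 unfolding pk by (simp add: field_simps)
      qed
      ultimately show False using p by simp
    qed
    then have finS: "finite S" using finite_nat_set_iff_bounded_le by blast
    have "0 \<in> S" using z by (simp add: S_def)
    then have M: "Max S \<in> S" using finS Max_in by blast
    define u where "u = z / p ^ Max S"
    have "inverse u \<in> V"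
    proof (rule ccontr)
      assume "inverse u \<notin> V"
      moreover have "u \<in> V" using M by (simp add: u_def S_def)
      ultimately have "u / p \<in> V" using maxp by blast
      then have "Suc (Max S) \<in> S" by (simp add: S_def u_def mult.commute)
      then show False using Max_ge[OF finS] by fastforce
    qed
    then show ?thesis using M p0
      by (intro exI[of _ u] exI[of _ "Max S"]) (auto simp: u_def S_def)
  qed
  then show ?thesis using p p0 by blast
qed

end


section \<open>Branches in an algebraic closure of the Laurent series field\<close>

text \<open>This makes the polynomial ring over \<open>K[[X]]\<close> factorial.\<close>

instance fps :: (field) semiring_gcd_mult_normalize ..

definition series_embedding :: "'k::field fps \<Rightarrow> 'k fps fract alg_closure" where
  "series_embedding a = to_ac (to_fract a)"

interpretation embedding: power_series_hom series_embedding
  by unfold_locales (simp_all add: series_embedding_def)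

text \<open>If \<open>w = a b\<close> in \<open>A[Y]\<close>, then one factor, say \<open>a\<close>, is a unit of \<open>A[[Y]]\<close>, so \<open>w\<close> divides \<open>b\<close> as a
  power series and hence as a polynomial. Cancelling \<open>w\<close> shows that \<open>a\<close> is a unit of \<open>A[Y]\<close>. In the
  factorial ring \<open>A[Y]\<close>, irreducible elements are prime.\<close>

lemma distinguished_irreducible_imp_prime_elem:
  fixes w :: "'k::field fps poly"
  assumes w: "distinguished w" and irr: "Factorial_Ring.irreducible (fps_of_poly w)"
  shows "prime_elem w"
proof (rule irreducible_imp_prime_elem, rule irreducibleI)
  have "fps_of_poly a dvd 1" if "a dvd 1" for a :: "'k fps poly"
    using that by (metis dvdE dvdI fps_of_poly_1 fps_of_poly_mult)
  then show "w \<noteq> 0" "\<not> w dvd 1"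
    using irr by (auto simp: Factorial_Ring.irreducible_def)
  have unit: "a dvd 1" if ab: "w = a * b" and a: "fps_of_poly a dvd 1" for a b
  proof -
    obtain u where u: "1 = fps_of_poly a * u" using a by (elim dvdE)
    have "fps_of_poly b = (fps_of_poly a * u) * fps_of_poly b" by (simp flip: u)
    also have "\<dots> = u * fps_of_poly w" by (simp add: ab fps_of_poly_mult mult_ac)
    finally obtain s where "b = s * w" using fps_of_poly_dvd_distinguished[OF w] by blast
    then have "w * 1 = w * (a * s)" using ab by (simp add: mult_ac)
    then have "1 = a * s" using \<open>w \<noteq> 0\<close> by (metis mult_left_cancel)
    then show "a dvd 1" by (metis dvdI)
  qed
  fix a b assume ab: "w = a * b"
  then have "fps_of_poly a dvd 1 \<or> fps_of_poly b dvd 1"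
    by (intro irreducibleD[OF irr]) (simp add: fps_of_poly_mult)
  then show "a dvd 1 \<or> b dvd 1" using unit ab by (metis mult.commute)
qed

context power_series_hom
begin

lemma ev_diff: "ev (p - q) z = ev p z - ev q z"
  using ev_add[of "p - q" q z] by simp

text \<open>Let \<open>m \<noteq> 0\<close> have the root \<open>\<theta>\<close> and minimal degree. Pseudo-division of \<open>w\<close> by \<open>m\<close> gives \<open>c w = m s\<close> with
  a constant \<open>c \<noteq> 0\<close>. The prime \<open>w\<close> divides \<open>m\<close> or \<open>s\<close>; in the second case \<open>m\<close> is a nonzero constant,
  which has no root. So \<open>w\<close> itself has minimal degree, and division by \<open>w\<close> leaves no remainder.\<close>

lemma prime_root_iff_dvd:
  assumes w: "prime_elem w" "lead_coeff w = 1" and root: "ev w \<theta> = 0"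
  shows "ev p \<theta> = 0 \<longleftrightarrow> w dvd p"
proof
  assume "w dvd p"
  then show "ev p \<theta> = 0" using root by (auto simp: ev_mult)
next
  assume p: "ev p \<theta> = 0"
  have nz: "w \<noteq> 0" using w by auto
  have min: "Polynomial.degree w \<le> Polynomial.degree q" if q: "q \<noteq> 0" "ev q \<theta> = 0" for q
  proof -
    define m where "m = arg_min Polynomial.degree (\<lambda>q. q \<noteq> 0 \<and> ev q \<theta> = 0)"
    have m: "m \<noteq> 0" "ev m \<theta> = 0"
      and le: "\<And>q. q \<noteq> 0 \<Longrightarrow> ev q \<theta> = 0 \<Longrightarrow> Polynomial.degree m \<le> Polynomial.degree q"
      using arg_min_natI[of "\<lambda>q. q \<noteq> 0 \<and> ev q \<theta> = 0" q Polynomial.degree]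
        arg_min_nat_le[of "\<lambda>q. q \<noteq> 0 \<and> ev q \<theta> = 0" _ Polynomial.degree] q
      unfolding m_def by blast+
    obtain c s where c: "c \<noteq> 0" "smult c w = m * s + pseudo_mod w m"
      using pseudo_mod(1)[OF m(1), of w] by blast
    have "ev (pseudo_mod w m) \<theta> = 0"
      using arg_cong[OF c(2), of "\<lambda>q. ev q \<theta>"] root m by (simp add: ev_smult ev_add ev_mult)
    then have "pseudo_mod w m = 0"
      using pseudo_mod(2)[OF m(1), of w] le[of "pseudo_mod w m"] by linarith
    then have ms: "smult c w = m * s" using c by simp
    then have "w dvd m * s" by (metis dvd_smult dvd_refl)
    then consider "w dvd m" | "w dvd s" using w(1) prime_elem_dvd_mult_iff by blast
    then have "Polynomial.degree w \<le> Polynomial.degree m"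
    proof cases
      case 1
      then show ?thesis using m by (intro dvd_imp_degree_le) auto
    next
      case 2
      have s0: "s \<noteq> 0" using ms c(1) nz by auto
      then have "Polynomial.degree w \<le> Polynomial.degree s" using 2 by (intro dvd_imp_degree_le) auto
      moreover have "Polynomial.degree w = Polynomial.degree m + Polynomial.degree s"
        using arg_cong[OF ms, of Polynomial.degree] c(1) m s0 by (simp add: degree_mult_eq)
      ultimately have "Polynomial.degree m = 0" by simp
      then obtain a where "m = [:a:]" by (elim degree_eq_zeroE)
      then show ?thesis using m hom_nz by (simp add: hom_0)
    qed
    then show ?thesis using le[OF q] by simp
  qed
  obtain q r where qr: "p = w * q + r" "r = 0 \<or> Polynomial.degree r < Polynomial.degree w"
    using monic_division[OF w(2)] by blast
  have "ev r \<theta> = 0" using p root by (simp add: qr(1) ev_add ev_mult)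
  then have "r = 0" using min[of r] qr(2) by (metis leD)
  then show "w dvd p" by (simp add: qr(1))
qed

end

text \<open>The ring \<open>K[[X]][\<theta>]\<close> is in the span of \<open>1, \<theta>, \<dots>, \<theta>\<^bsup>n-1\<^esup>\<close> over the field of fractions of
  \<open>K[[X]]\<close>, so \<open>1, d, \<dots>, d\<^sup>n\<close> are linearly dependent for each of its elements \<open>d\<close>. Clearing
  denominators gives an equation over \<open>K[[X]]\<close>.\<close>

lemma embedding_root_bounded_degree:
  fixes w :: "'k::field fps poly"
  assumes w: "lead_coeff w = 1" "embedding.ev w \<theta> = 0"
  shows "\<exists>q. q \<noteq> 0 \<and> Polynomial.degree q \<le> Polynomial.degree w \<and>
             embedding.ev q (embedding.ev p \<theta>) = 0"
proof -
  define n where "n = Polynomial.degree w"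
  define scale :: "'k fps fract \<Rightarrow> 'k fps fract alg_closure \<Rightarrow> 'k fps fract alg_closure"
    where "scale c z = to_ac c * z" for c z
  interpret vs: vector_space scale
    by unfold_locales (simp_all add: scale_def algebra_simps)
  define B where "B = (\<lambda>i. \<theta> ^ i) ` {..<n}"
  define d where "d = embedding.ev p \<theta>"
  have span: "embedding.ev q \<theta> \<in> vs.span B" for q
  proof -
    obtain s r where sr: "q = w * s + r" "r = 0 \<or> Polynomial.degree r < n"
      using monic_division[OF w(1)] unfolding n_def by blast
    have "embedding.ev q \<theta> = embedding.ev r \<theta>"
      using w(2) by (simp add: sr(1) embedding.ev_add embedding.ev_mult)
    also have "\<dots> \<in> vs.span B"
    proof (cases "r = 0")
      case False
      have "embedding.ev r \<theta> =
          (\<Sum>i\<le>Polynomial.degree r. scale (to_fract (poly.coeff r i)) (\<theta> ^ i))"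
        by (simp add: embedding.ev_sum scale_def series_embedding_def)
      also have "\<dots> \<in> vs.span B"
        using False sr(2) by (intro vs.span_sum vs.span_scale vs.span_base) (auto simp: B_def)
      finally show ?thesis .
    qed (simp add: vs.span_zero)
    finally show ?thesis .
  qed
  have dp: "d ^ i = embedding.ev (p ^ i) \<theta>" for i
    by (induction i) (simp_all add: d_def embedding.ev_mult one_pCons embedding.hom_1)
  obtain r :: "'k fps fract poly" where r: "r \<noteq> 0" "Polynomial.degree r \<le> n" "poly (map_poly to_ac r) d = 0"
  proof (cases "inj_on (\<lambda>i. d ^ i) {..n}")
    case False
    then obtain i j where ij: "i \<le> n" "j \<le> n" "i \<noteq> j" "d ^ i = d ^ j" by (auto simp: inj_on_def)
    define r :: "'k fps fract poly" where "r = monom 1 i - monom 1 j"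
    have "poly.coeff r i = 1" using ij by (simp add: r_def)
    then have "r \<noteq> 0" by auto
    moreover have "Polynomial.degree r \<le> n"
      unfolding r_def using ij by (intro degree_diff_le order_trans[OF degree_monom_le]) auto
    moreover have "map_poly to_ac r = monom 1 i - monom 1 j"
      by (rule poly_eqI) (simp add: r_def coeff_map_poly)
    then have "poly (map_poly to_ac r) d = 0" using ij by (simp add: poly_monom)
    ultimately show ?thesis using that by blast
  next
    case True
    define S where "S = (\<lambda>i. d ^ i) ` {..n}"
    have "card S = Suc n" using True by (simp add: S_def card_image)
    moreover have "card B \<le> n" unfolding B_def by (metis card_image_le card_lessThan finite_lessThan)
    moreover have "S \<subseteq> vs.span B" using span by (auto simp: S_def dp)
    ultimately have "vs.dependent S"
      using vs.independent_span_bound[of B S] by (auto simp: B_def)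
    then obtain u v where u: "v \<in> S" "u v \<noteq> 0" "(\<Sum>v\<in>S. scale (u v) v) = 0"
      using vs.dependent_finite[of S] by (auto simp: S_def)
    define r where "r = (\<Sum>i\<le>n. monom (u (d ^ i)) i)"
    have cr: "poly.coeff r i = (if i \<le> n then u (d ^ i) else 0)" for i
      by (simp add: r_def coeff_sum)
    obtain j where "j \<le> n" "v = d ^ j" using u(1) by (auto simp: S_def)
    then have "r \<noteq> 0" using cr[of j] u(2) by auto
    moreover have deg: "Polynomial.degree r \<le> n" by (rule degree_le) (simp add: cr)
    moreover have "poly (map_poly to_ac r) d = 0"
    proof -
      have "map_poly to_ac r = (\<Sum>i\<le>n. monom (to_ac (u (d ^ i))) i)"
        by (rule poly_eqI) (simp add: coeff_map_poly coeff_sum cr)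
      then have "poly (map_poly to_ac r) d = (\<Sum>i\<le>n. scale (u (d ^ i)) (d ^ i))"
        by (simp add: poly_sum poly_monom scale_def)
      also have "\<dots> = (\<Sum>v\<in>S. scale (u v) v)"
        unfolding S_def by (subst sum.reindex[OF True]) simp
      finally show ?thesis using u(3) by simp
    qed
    ultimately show ?thesis using that by blast
  qed
  obtain c q where q: "r = smult c (map_poly to_fract q)"
    using content_decompose_fract[of r] by blast
  have c0: "c \<noteq> 0" "q \<noteq> 0" using r(1) q by auto
  have "map_poly to_ac r = smult (to_ac c) (map_poly series_embedding q)"
    by (rule poly_eqI) (simp add: q coeff_map_poly embedding.hom_0, simp add: series_embedding_def)
  then have "embedding.ev q d = 0" using r(3) c0 by (simp add: embedding.ev_def)
  moreover have "Polynomial.degree q \<le> n"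
    using r(2) c0 by (simp add: q degree_map_poly)
  ultimately show ?thesis using c0 unfolding d_def n_def by blast
qed


text \<open>Then \<open>\<phi>\<close> identifies \<open>K[[X]][[Y]]/\<langle>f\<rangle>\<close> with a subring of a field to which the preceding section
  applies. For \<open>f = X\<close>, the series embedded by \<open>series_embedding\<close> are those in \<open>Y\<close>.\<close>

definition branch_parametrization ::
    "'k::field fps fps \<Rightarrow> ('k fps fps \<Rightarrow> 'k fps fract alg_closure) \<Rightarrow> bool" where
  "branch_parametrization f \<phi> \<longleftrightarrow>
     \<phi> 1 = 1 \<and> (\<forall>g h. \<phi> (g + h) = \<phi> g + \<phi> h \<and> \<phi> (g * h) = \<phi> g * \<phi> h) \<and>
     (\<forall>g. \<phi> g = 0 \<longleftrightarrow> f dvd g) \<and> (\<exists>n. curve_model series_embedding (range \<phi>) n)"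

text \<open>The variable \<open>Y\<close> is mapped to a root of \<open>w\<close>. A power series cannot be evaluated there directly, but
  by Weierstrass division it is congruent to a polynomial modulo \<open>w\<close>.\<close>

lemma distinguished_parametrization:
  fixes w :: "'k::field fps poly"
  assumes w: "distinguished w" and irr: "Factorial_Ring.irreducible (fps_of_poly w)"
    and deg: "Polynomial.degree w > 0"
  shows "\<exists>\<phi>. branch_parametrization (fps_of_poly w) \<phi>"
proof -
  have lc: "lead_coeff w = 1" using w by (simp add: distinguished_def)
  have prime: "prime_elem w" by (rule distinguished_irreducible_imp_prime_elem[OF w irr])
  have "Polynomial.degree (map_poly series_embedding w) > 0"
    using deg by (simp add: degree_map_poly embedding.hom_nz)
  then obtain \<theta> where root: "embedding.ev w \<theta> = 0"
    using alg_closed_imp_poly_has_root unfolding embedding.ev_def by blast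
  note ker = embedding.prime_root_iff_dvd[OF prime lc root]
  let ?w = "fps_of_poly w"
  define \<phi> where "\<phi> g = embedding.ev (SOME p. ?w dvd g - fps_of_poly p) \<theta>" for g
  have rep: "\<exists>p. ?w dvd g - fps_of_poly p" for g
    using weierstrass_division[OF distinguished_regular[OF w], of g] by (metis add_diff_cancel_right' dvd_triv_right)
  have dvd: "w dvd p \<longleftrightarrow> ?w dvd fps_of_poly p" for p
  proof
    assume "?w dvd fps_of_poly p"
    then obtain q where "fps_of_poly p = q * ?w" by (metis dvdE mult.commute)
    then obtain s where "p = s * w" using fps_of_poly_dvd_distinguished[OF w] by blast
    then show "w dvd p" by simp
  qed (auto simp: fps_of_poly_mult)
  have eq: "\<phi> g = embedding.ev p \<theta>" if "?w dvd g - fps_of_poly p" for g p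
  proof -
    define q where "q = (SOME p. ?w dvd g - fps_of_poly p)"
    have "?w dvd g - fps_of_poly q" unfolding q_def by (rule someI_ex[OF rep])
    then have "?w dvd (g - fps_of_poly p) - (g - fps_of_poly q)" using that by (rule dvd_diff[rotated])
    then have "w dvd q - p" by (simp add: dvd fps_of_poly_diff)
    then have "embedding.ev (q - p) \<theta> = 0" by (simp add: ker)
    then show ?thesis by (simp add: \<phi>_def q_def[symmetric] embedding.ev_diff)
  qed
  have poly: "\<phi> (fps_of_poly p) = embedding.ev p \<theta>" for p
    by (rule eq) simp
  have add: "\<phi> (g + h) = \<phi> g + \<phi> h" and mult: "\<phi> (g * h) = \<phi> g * \<phi> h" for g h
  proof -
    obtain p q where pq: "?w dvd g - fps_of_poly p" "?w dvd h - fps_of_poly q" using rep by blast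
    have "g + h - fps_of_poly (p + q) = (g - fps_of_poly p) + (h - fps_of_poly q)"
      by (simp add: fps_of_poly_add)
    then have "\<phi> (g + h) = embedding.ev (p + q) \<theta>" using pq by (intro eq) (simp only: dvd_add)
    then show "\<phi> (g + h) = \<phi> g + \<phi> h" by (simp add: embedding.ev_add eq[OF pq(1)] eq[OF pq(2)])
    have "g * h - fps_of_poly (p * q) = (g - fps_of_poly p) * h + fps_of_poly p * (h - fps_of_poly q)"
      by (simp add: fps_of_poly_mult algebra_simps)
    then have "\<phi> (g * h) = embedding.ev (p * q) \<theta>" using pq by (intro eq) (simp only: dvd_add dvd_mult dvd_mult2)
    then show "\<phi> (g * h) = \<phi> g * \<phi> h" by (simp add: embedding.ev_mult eq[OF pq(1)] eq[OF pq(2)])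
  qed
  have const: "\<phi> (fps_const a) = series_embedding a" for a
    using poly[of "[:a:]"] by (simp add: fps_of_poly_const)
  have one: "\<phi> 1 = 1" using const[of 1] by (simp add: embedding.hom_1)
  have zero: "\<phi> g = 0 \<longleftrightarrow> ?w dvd g" for g
  proof -
    obtain p where p: "?w dvd g - fps_of_poly p" using rep by blast
    have "?w dvd g \<longleftrightarrow> ?w dvd fps_of_poly p"
      using p by (metis dvd_add_right_iff diff_add_cancel)
    then show ?thesis by (simp add: eq[OF p] ker dvd)
  qed
  have range: "\<exists>p. \<phi> g = embedding.ev p \<theta>" for g using rep eq by blast
  have "curve_model series_embedding (range \<phi>) (Polynomial.degree w)"
  proof unfold_locales
    fix a show "series_embedding a \<in> range \<phi>" by (metis const rangeI)
  next
    fix c d assume "c \<in> range \<phi>" "d \<in> range \<phi>"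
    then obtain g h where "c = \<phi> g" "d = \<phi> h" by blast
    then have "c + d = \<phi> (g + h)" "c * d = \<phi> (g * h)" by (simp_all add: add mult)
    then show "c + d \<in> range \<phi>" "c * d \<in> range \<phi>" by blast+
  next
    show "inverse (series_embedding fps_X) \<notin> range \<phi>"
    proof
      assume "inverse (series_embedding fps_X) \<in> range \<phi>"
      then obtain g where "inverse (series_embedding fps_X) = \<phi> g" by blast
      then have "\<phi> (fps_const fps_X * g) = series_embedding fps_X * inverse (series_embedding fps_X)"
        by (simp add: mult const)
      then have "\<phi> (fps_const fps_X * g) = 1"
        by (simp add: embedding.hom_X_nz)
      then have "\<phi> (fps_const fps_X * g - 1) = 0"
        using add[of "fps_const fps_X * g - 1" 1] one by simp
      then obtain k where k: "fps_const fps_X * g - 1 = ?w * k" using zero by (auto elim: dvdE)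
      have "fps_X dvd poly.coeff w 0" using w deg by (simp add: distinguished_def)
      then have "fps_X dvd fps_X * fps_nth g 0 - fps_nth (?w * k) 0"
        by (simp add: fps_mult_nth_0)
      moreover have "fps_X * fps_nth g 0 - fps_nth (?w * k) 0 = 1"
        using arg_cong[OF k, of "\<lambda>h. fps_nth h 0"] by (simp add: algebra_simps)
      ultimately have "fps_X dvd (1 :: 'k fps)" by metis
      then show False by (simp add: fps_X_dvd_iff)
    qed
  next
    fix d assume "d \<in> range \<phi>"
    then obtain p where "d = embedding.ev p \<theta>" using range by blast
    then show "\<exists>q. q \<noteq> 0 \<and> Polynomial.degree q \<le> Polynomial.degree w \<and> embedding.ev q d = 0"
      using embedding_root_bounded_degree[OF lc root] by blast
  qed
  then show ?thesis
    unfolding branch_parametrization_def using one add mult zero by blast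
qed

text \<open>The coordinate ring of the branch \<open>\<langle>X\<rangle>\<close> is \<open>K[[Y]]\<close>: put \<open>X = 0\<close>. It is the image of
  \<open>series_embedding\<close>, and its elements satisfy equations of degree 1.\<close>

lemma axis_parametrization:
  "\<exists>\<phi>. branch_parametrization (fps_const fps_X :: 'k::field fps fps) \<phi>"
proof -
  define \<sigma> :: "'k fps fps \<Rightarrow> 'k fps" where "\<sigma> g = Abs_fps (\<lambda>i. fps_nth (fps_nth g i) 0)" for g
  have add: "\<sigma> (g + h) = \<sigma> g + \<sigma> h" and mult: "\<sigma> (g * h) = \<sigma> g * \<sigma> h" for g h
    by (rule fps_ext, simp add: \<sigma>_def fps_mult_nth fps_sum_nth)+
  have one: "\<sigma> 1 = 1" by (rule fps_ext) (simp add: \<sigma>_def)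
  have zero: "\<sigma> g = 0 \<longleftrightarrow> fps_const fps_X dvd g" for g
  proof
    assume "\<sigma> g = 0"
    then have "fps_X dvd fps_nth g i" for i
    proof -
      have "fps_nth (\<sigma> g) i = 0" using \<open>\<sigma> g = 0\<close> by simp
      then show ?thesis by (simp add: \<sigma>_def fps_X_dvd_iff)
    qed
    then obtain h where "\<And>i. fps_nth g i = fps_X * h i" unfolding dvd_def by metis
    then have "g = fps_const fps_X * Abs_fps h" by (intro fps_ext) simp
    then show "fps_const fps_X dvd g" by (metis dvdI)
  next
    assume "fps_const fps_X dvd g"
    then show "\<sigma> g = 0" by (auto simp: \<sigma>_def intro!: fps_ext elim!: dvdE)
  qed
  have surj: "\<exists>g. \<sigma> g = a" for a
    by (rule exI[of _ "Abs_fps (\<lambda>i. fps_const (fps_nth a i))"]) (rule fps_ext, simp add: \<sigma>_def)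
  define \<phi> where "\<phi> g = series_embedding (\<sigma> g)" for g
  have range: "range \<phi> = range series_embedding"
    unfolding \<phi>_def using surj by (auto simp: image_iff) metis
  have "curve_model series_embedding (range \<phi> :: 'k fps fract alg_closure set) 1"
    unfolding range
  proof unfold_locales
    fix c d :: "'k fps fract alg_closure"
    assume "c \<in> range series_embedding" "d \<in> range series_embedding"
    then obtain a b where "c = series_embedding a" "d = series_embedding b" by blast
    then have "c + d = series_embedding (a + b)" "c * d = series_embedding (a * b)"
      by (simp_all add: embedding.hom_add embedding.hom_mult)
    then show "c + d \<in> range series_embedding" "c * d \<in> range series_embedding" by blast+
  next
    show "inverse (series_embedding fps_X) \<notin> range (series_embedding :: 'k fps \<Rightarrow> _)"
    proof
      assume "inverse (series_embedding fps_X) \<in> range (series_embedding :: 'k fps \<Rightarrow> _)"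
      then obtain a :: "'k fps" where "inverse (series_embedding fps_X) = series_embedding a" by blast
      then have "series_embedding (fps_X * a) = series_embedding 1"
        by (simp add: embedding.hom_mult embedding.hom_1 embedding.hom_X_nz flip: \<open>inverse _ = _\<close>)
      then have "fps_X * a = 1" by (simp only: series_embedding_def to_ac_eq_iff to_fract_eq_iff)
      then show False by (metis dvdI fps_X_dvd_iff fps_one_nth zero_neq_one)
    qed
  next
    fix d :: "'k fps fract alg_closure" assume "d \<in> range series_embedding"
    then obtain a where "d = series_embedding a" by blast
    then have "embedding.ev [:-a, 1:] d = 0"
      by (simp add: embedding.hom_1 embedding.hom_uminus)
    then show "\<exists>q. q \<noteq> 0 \<and> Polynomial.degree q \<le> 1 \<and> embedding.ev q d = 0"
      by (intro exI[of _ "[:-a, 1:]"]) simp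
  qed auto
  then show ?thesis
    unfolding branch_parametrization_def
    by (intro exI[of _ \<phi>]) (auto simp: \<phi>_def add mult one embedding.hom_1 embedding.hom_add
        embedding.hom_mult zero[symmetric] embedding.hom_0 dest: embedding.hom_nz)
qed

text \<open>Either \<open>X\<close> divides \<open>f\<close>, and then \<open>f\<close> is associated with \<open>X\<close>, or \<open>f\<close> is nonzero modulo \<open>X\<close>, and then
  \<open>f\<close> is associated with a distinguished polynomial.\<close>

theorem branch_parametrization_exists:
  fixes f :: "'k::field fps fps"
  assumes irr: "Factorial_Ring.irreducible f"
  shows "\<exists>\<phi>. branch_parametrization f \<phi>"
proof -
  have assoc: "\<exists>\<phi>. branch_parametrization f \<phi>"
    if "f = u * g" "u dvd 1" "\<exists>\<phi>. branch_parametrization g \<phi>" for u g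
  proof -
    obtain v where v: "1 = u * v" using \<open>u dvd 1\<close> by (elim dvdE)
    have "f dvd h \<longleftrightarrow> g dvd h" for h
    proof
      have "h = u * v * h" by (simp flip: v)
      also have "\<dots> = u * (v * h)" by (rule mult.assoc)
      finally have h: "h = u * (v * h)" .
      assume "g dvd h"
      then have "g dvd v * h" by simp
      then have "u * g dvd u * (v * h)" by (rule mult_dvd_mono[OF dvd_refl])
      then show "f dvd h" by (simp only: \<open>f = _\<close> flip: h)
    qed (simp only: \<open>f = _\<close>, rule dvd_mult_right)
    then show ?thesis using that(3) by (simp add: branch_parametrization_def)
  qed
  show ?thesis
  proof (cases "\<forall>i. fps_X dvd fps_nth f i")
    case True
    then obtain h where "\<And>i. fps_nth f i = fps_X * h i" unfolding dvd_def by metis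
    then have f: "f = Abs_fps h * fps_const fps_X" by (intro fps_ext) simp
    have "\<not> fps_const fps_X dvd (1 :: 'k fps fps)"
    proof
      assume "fps_const fps_X dvd (1 :: 'k fps fps)"
      then obtain g :: "'k fps fps" where "1 = fps_const fps_X * g" by (elim dvdE)
      then have "fps_nth 1 0 = fps_X * fps_nth g 0" by (metis fps_mult_left_const_nth)
      then show False by (metis dvdI fps_X_dvd_iff fps_one_nth zero_neq_one)
    qed
    then have "Abs_fps h dvd 1" using irreducibleD[OF irr f] by blast
    then show ?thesis using assoc[OF f] axis_parametrization by blast
  next
    case False
    define n where "n = (LEAST i. \<not> fps_X dvd fps_nth f i)"
    have "\<not> fps_X dvd fps_nth f n" unfolding n_def by (rule LeastI_ex) (use False in blast)
    moreover have "fps_X dvd fps_nth f i" if "i < n" for i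
      using not_less_Least that unfolding n_def by blast
    ultimately have "weierstrass_regular n f"
      by (simp add: weierstrass_regular_def fps_X_dvd_iff)
    then obtain w u where w: "distinguished w" "Polynomial.degree w = n" "u dvd 1" "f = u * fps_of_poly w"
      using weierstrass_preparation by blast
    have irr': "Factorial_Ring.irreducible (fps_of_poly w)"
    proof (rule irreducibleI)
      show "fps_of_poly w \<noteq> 0" "\<not> fps_of_poly w dvd 1"
        using irr mult_dvd_mono[OF w(3), of "fps_of_poly w" 1]
        by (auto simp: w(4) Factorial_Ring.irreducible_def)
    next
      fix a b assume "fps_of_poly w = a * b"
      then have "u * a dvd 1 \<or> b dvd 1" by (intro irreducibleD[OF irr]) (simp add: w(4) mult.assoc)
      then show "a dvd 1 \<or> b dvd 1" using dvd_mult_right by blast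
    qed
    have "n > 0"
    proof (rule ccontr)
      assume "\<not> n > 0"
      then have "w = 1" using w(1,2) by (auto simp: distinguished_def elim!: degree_eq_zeroE)
      then show False using irr' by simp
    qed
    then show ?thesis using assoc[OF w(4,3)] distinguished_parametrization w irr' by blast
  qed
qed


section \<open>The normalized valuation of a branch\<close>

lemma cring_of_image:
  fixes F :: "'o::comm_ring_1 \<Rightarrow> 'b" and K :: "'b ring"
  assumes carrier: "carrier K = F ` S"
    and S: "0 \<in> S" "1 \<in> S" "\<And>a b. a \<in> S \<Longrightarrow> b \<in> S \<Longrightarrow> a + b \<in> S"
      "\<And>a b. a \<in> S \<Longrightarrow> b \<in> S \<Longrightarrow> a * b \<in> S" "\<And>a. a \<in> S \<Longrightarrow> - a \<in> S"
    and ops: "\<And>a b. a \<in> S \<Longrightarrow> b \<in> S \<Longrightarrow> F a \<otimes>\<^bsub>K\<^esub> F b = F (a * b)"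
      "\<And>a b. a \<in> S \<Longrightarrow> b \<in> S \<Longrightarrow> F a \<oplus>\<^bsub>K\<^esub> F b = F (a + b)"
      "\<one>\<^bsub>K\<^esub> = F 1" "\<zero>\<^bsub>K\<^esub> = F 0"
  shows "cring K"
proof (rule cringI)
  show "abelian_group K"
  proof (rule abelian_groupI)
    fix x assume "x \<in> carrier K"
    then obtain a where "a \<in> S" "x = F a" by (auto simp: carrier)
    then show "\<exists>y\<in>carrier K. y \<oplus>\<^bsub>K\<^esub> x = \<zero>\<^bsub>K\<^esub>"
      using S by (intro bexI[of _ "F (- a)"]) (auto simp: carrier ops)
  qed (auto simp: carrier ops S algebra_simps)
  show "comm_monoid K"
    by (rule comm_monoidI) (auto simp: carrier ops S algebra_simps)
qed (auto simp: carrier ops S algebra_simps)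

text \<open>The map \<open>C\<close> is an isomorphism from \<open>D\<close> to the ring \<open>Q\<close>. For a branch, \<open>Q\<close> is the quotient ring, and
  \<open>C d\<close> is the coset of the series that \<open>\<phi>\<close> maps to \<open>d\<close>. The purpose is to replace computations with
  classes of pairs of cosets by computations in a field.\<close>

locale curve_model_ring = curve_model \<psi> D n
    for \<psi> :: "'k::field fps \<Rightarrow> 'o::field" and D :: "'o set" and n :: nat +
  fixes Q :: "'b ring" and C :: "'o \<Rightarrow> 'b"
  assumes carrier_Q: "carrier Q = C ` D" and inj_C: "inj_on C D"
    and C_mult: "a \<in> D \<Longrightarrow> b \<in> D \<Longrightarrow> C a \<otimes>\<^bsub>Q\<^esub> C b = C (a * b)"
    and C_add: "a \<in> D \<Longrightarrow> b \<in> D \<Longrightarrow> C a \<oplus>\<^bsub>Q\<^esub> C b = C (a + b)"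
    and C_1: "\<one>\<^bsub>Q\<^esub> = C 1" and C_0: "\<zero>\<^bsub>Q\<^esub> = C 0"
begin

text \<open>This is the element of the field of fractions of \<open>Q\<close> that corresponds to \<open>z\<close>.\<close>

definition F :: "'o \<Rightarrow> ('b \<times> 'b) set" where
  "F z = {(C c, C d) | c d. c \<in> D \<and> d \<in> D \<and> d \<noteq> 0 \<and> c = z * d}"

abbreviation "K \<equiv> fraction_field Q"
abbreviation "W \<equiv> integral_closure Q"

lemma C_eq_iff: "a \<in> D \<Longrightarrow> b \<in> D \<Longrightarrow> C a = C b \<longleftrightarrow> a = b"
  using inj_C by (auto simp: inj_on_def)

lemma fraction_C:
  assumes "a \<in> D" "b \<in> D" "b \<noteq> 0"
  shows "fraction Q (C a) (C b) = F (a / b)"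
proof -
  have "fraction Q (C a) (C b) =
      {(C c, C d) | c d. c \<in> D \<and> d \<in> D \<and> d \<noteq> 0 \<and> a * d = c * b}"
    using assms D_0 D_mult by (auto simp: fraction_def carrier_Q C_0 C_mult C_eq_iff; blast)
  moreover have "a * d = c * b \<longleftrightarrow> c = a / b * d" for c d
    using assms by (auto simp: field_simps)
  ultimately show ?thesis by (simp add: F_def)
qed

lemma L_E:
  assumes "z \<in> L"
  obtains a b where "a \<in> D" "b \<in> D" "b \<noteq> 0" "z = a / b"
  using assms by (auto simp: L_def)

lemma F_nonempty: "z \<in> L \<Longrightarrow> \<exists>c d. c \<in> D \<and> d \<in> D \<and> d \<noteq> 0 \<and> c = z * d"
  by (elim L_E) force

lemma F_eq_iff:
  assumes "z \<in> L" "w \<in> L"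
  shows "F z = F w \<longleftrightarrow> z = w"
proof
  assume eq: "F z = F w"
  obtain c d where cd: "c \<in> D" "d \<in> D" "d \<noteq> 0" "c = z * d" using F_nonempty assms(1) by blast
  then have "(C c, C d) \<in> F z" unfolding F_def by blast
  then have "(C c, C d) \<in> F w" by (simp only: eq)
  then obtain c' d' where "C c = C c'" "C d = C d'" "c' \<in> D" "d' \<in> D" "c' = w * d'"
    unfolding F_def by blast
  then have "c = w * d" using cd C_eq_iff by metis
  then show "z = w" using cd by simp
qed simp

lemma carrier_K: "carrier K = F ` L"
proof -
  have nz: "carrier Q - {\<zero>\<^bsub>Q\<^esub>} = C ` (D - {0})"
    using D_0 by (auto simp: carrier_Q C_0 C_eq_iff)
  have "carrier K = (\<lambda>(a, b). fraction Q a b) ` (carrier Q \<times> (carrier Q - {\<zero>\<^bsub>Q\<^esub>}))"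
    by (auto simp: fraction_field_def image_iff)
  also have "\<dots> = (\<lambda>(a, b). fraction Q (C a) (C b)) ` (D \<times> (D - {0}))"
    unfolding nz unfolding carrier_Q by force
  also have "\<dots> = (\<lambda>(a, b). F (a / b)) ` (D \<times> (D - {0}))"
    by (intro image_cong) (auto simp: fraction_C)
  also have "\<dots> = F ` L" unfolding L_def by force
  finally show ?thesis .
qed

lemma K_1: "\<one>\<^bsub>K\<^esub> = F 1" and K_0: "\<zero>\<^bsub>K\<^esub> = F 0"
  using fraction_C[OF D_1 D_1] fraction_C[OF D_0 D_1]
  by (simp_all add: fraction_field_def C_0 C_1)

text \<open>The operations of the field of fractions are unions over representatives, which contribute equal
  sets. There is a representative, so that the union is this set.\<close>

lemma Union_over_representatives:
  assumes "z \<in> L" "\<And>c d. c \<in> D \<Longrightarrow> d \<in> D \<Longrightarrow> d \<noteq> 0 \<Longrightarrow> c = z * d \<Longrightarrow> H (C c) (C d) = Y"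
  shows "(\<Union>(a, b)\<in>F z. H a b) = Y"
proof -
  have "F z \<noteq> {}" using F_nonempty[OF assms(1)] by (auto simp: F_def)
  moreover have "(case p of (a, b) \<Rightarrow> H a b) = Y" if "p \<in> F z" for p
    using that assms(2) by (auto simp: F_def)
  ultimately show ?thesis by simp
qed

lemma K_mult:
  assumes "z \<in> L" "w \<in> L"
  shows "F z \<otimes>\<^bsub>K\<^esub> F w = F (z * w)"
  unfolding fraction_field_def monoid.simps
proof (rule Union_over_representatives[OF assms(1)], rule Union_over_representatives[OF assms(2)])
  fix a b c d assume D: "a \<in> D" "b \<in> D" "b \<noteq> 0" "a = z * b" "c \<in> D" "d \<in> D" "d \<noteq> 0" "c = w * d"
  then have "fraction Q (C a \<otimes>\<^bsub>Q\<^esub> C c) (C b \<otimes>\<^bsub>Q\<^esub> C d) = F ((a * c) / (b * d))"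
    using D_mult by (simp add: C_mult fraction_C)
  also have "(a * c) / (b * d) = z * w" using D by simp
  finally show "fraction Q (C a \<otimes>\<^bsub>Q\<^esub> C c) (C b \<otimes>\<^bsub>Q\<^esub> C d) = F (z * w)" .
qed

lemma K_add:
  assumes "z \<in> L" "w \<in> L"
  shows "F z \<oplus>\<^bsub>K\<^esub> F w = F (z + w)"
  unfolding fraction_field_def ring.simps monoid.simps
proof (rule Union_over_representatives[OF assms(1)], rule Union_over_representatives[OF assms(2)])
  fix a b c d assume D: "a \<in> D" "b \<in> D" "b \<noteq> 0" "a = z * b" "c \<in> D" "d \<in> D" "d \<noteq> 0" "c = w * d"
  then have "fraction Q ((C a \<otimes>\<^bsub>Q\<^esub> C d) \<oplus>\<^bsub>Q\<^esub> (C c \<otimes>\<^bsub>Q\<^esub> C b)) (C b \<otimes>\<^bsub>Q\<^esub> C d)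
      = F ((a * d + c * b) / (b * d))"
    using D_mult D_add by (simp add: C_mult C_add fraction_C)
  also have "(a * d + c * b) / (b * d) = z + w" using D by (simp add: field_simps)
  finally show "fraction Q ((C a \<otimes>\<^bsub>Q\<^esub> C d) \<oplus>\<^bsub>Q\<^esub> (C c \<otimes>\<^bsub>Q\<^esub> C b)) (C b \<otimes>\<^bsub>Q\<^esub> C d) = F (z + w)" .
qed

lemma L_uminus: "z \<in> L \<Longrightarrow> - z \<in> L"
  using L_mult[OF D_L[OF D_uminus[OF D_1]]] by fastforce

lemma L_sum: "(\<And>i. i \<in> I \<Longrightarrow> f i \<in> L) \<Longrightarrow> sum f I \<in> L"
  by (induction I rule: infinite_finite_induct) (auto intro: D_L D_0 L_add)

lemma cring_K: "cring K"
  by (rule cring_of_image[OF carrier_K])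
    (simp_all add: D_L D_0 D_1 L_add L_mult L_uminus K_mult K_add K_0 K_1)

lemma to_K: "to_fraction_field Q (C a) = F a" if "a \<in> D"
  using fraction_C[OF that D_1] by (simp add: to_fraction_field_def C_1)

lemma K_power:
  assumes "z \<in> L"
  shows "F z [^]\<^bsub>K\<^esub> (k::nat) = F (z ^ k)"
proof -
  interpret K: cring K by (rule cring_K)
  show ?thesis
    by (induction k) (simp_all add: K_1 K_mult L_power assms mult.commute)
qed

text \<open>The leading coefficient comes first in the list, the coefficient of \<open>z\<^sup>0\<close> last.\<close>

lemma K_eval:
  assumes z: "z \<in> L"
  shows "set cs \<subseteq> D \<Longrightarrow> ring.eval K (map F cs) (F z) = F (\<Sum>i<length cs. rev cs ! i * z ^ i)"
proof (induction cs)
  interpret K: cring K by (rule cring_K)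
  {
    case Nil
    show ?case by (simp add: K_0)
  next
    case (Cons c cs)
    have s: "(\<Sum>i<length cs. rev cs ! i * z ^ i) \<in> L"
    proof (intro L_sum L_mult L_power z D_L)
      fix i assume "i \<in> {..<length cs}"
      then have "rev cs ! i \<in> set cs" by (metis length_rev lessThan_iff nth_mem set_rev)
      then show "rev cs ! i \<in> D" using Cons.prems by auto
    qed
    have c: "c \<in> L" using Cons.prems by (simp add: D_L)
    have "ring.eval K (map F (c # cs)) (F z) =
        F c \<otimes>\<^bsub>K\<^esub> (F z [^]\<^bsub>K\<^esub> length cs) \<oplus>\<^bsub>K\<^esub> ring.eval K (map F cs) (F z)"
      by simp
    also have "\<dots> = F (c * z ^ length cs + (\<Sum>i<length cs. rev cs ! i * z ^ i))"
      using Cons c z s by (simp add: K_power K_mult K_add L_power L_mult)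
    also have "c * z ^ length cs + (\<Sum>i<length cs. rev cs ! i * z ^ i)
        = (\<Sum>i<length (c # cs). rev (c # cs) ! i * z ^ i)"
      by (simp add: nth_append add.commute)
    finally show ?case .
  }
qed

lemma integral_over_K_iff:
  assumes z: "z \<in> L"
  shows "integral_over K (to_fraction_field Q ` carrier Q) (F z) \<longleftrightarrow> integral z"
proof -
  have img: "to_fraction_field Q ` carrier Q = F ` D"
    by (auto simp: carrier_Q to_K image_iff)
  have lists: "\<exists>cs. p = map F cs \<and> set cs \<subseteq> D" if "set p \<subseteq> F ` D" for p
    using that
  proof (induction p)
    case (Cons q p)
    then obtain c cs where "q = F c" "c \<in> D" "p = map F cs" "set cs \<subseteq> D" by auto
    then show ?case by (intro exI[of _ "c # cs"]) simp
  qed simp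
  show ?thesis
  proof
    assume "integral_over K (to_fraction_field Q ` carrier Q) (F z)"
    then obtain p where p: "p \<noteq> []" "hd p = F 1" "set p \<subseteq> F ` D" "ring.eval K p (F z) = F 0"
      by (auto simp: integral_over_def img K_1 K_0)
    then obtain c cs where cs: "p = map F (c # cs)" "set (c # cs) \<subseteq> D"
      using lists[of p] by (metis list.exhaust list.map_disc_iff)
    have c1: "c = 1" using p(2) cs F_eq_iff[of c 1] D_L D_1 by simp
    have inL: "(\<Sum>i<m. a i * z ^ i) \<in> L" if "\<And>i. i < m \<Longrightarrow> a i \<in> D" for a m
      using that by (intro L_sum L_mult L_power z D_L) simp
    have rc: "rev (c # cs) ! i \<in> D" if "i < length (c # cs)" for i
      using that cs(2) by (metis length_rev nth_mem set_rev subsetD)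
    have "F (\<Sum>i<length (c # cs). rev (c # cs) ! i * z ^ i) = F 0"
      using p(4) K_eval[OF z cs(2)] cs(1) by simp
    then have "(\<Sum>i<length (c # cs). rev (c # cs) ! i * z ^ i) = 0"
      using F_eq_iff[OF inL D_L[OF D_0]] rc by blast
    then have e: "(\<Sum>i<length cs. rev cs ! i * z ^ i) + z ^ length cs = 0"
      by (simp add: c1 nth_append)
    have "z ^ length cs = (\<Sum>i<length cs. - (rev cs ! i) * z ^ i)"
      using e by (simp add: sum_negf eq_neg_iff_add_eq_0 add.commute)
    moreover have "- (rev cs ! i) \<in> D" if "i < length cs" for i
      using rc[of i] that D_uminus by (simp add: nth_append)
    ultimately show "integral z" unfolding integral_def
      by (intro exI[of _ "length cs"] exI[of _ "\<lambda>i. - (rev cs ! i)"]) simp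
  next
    assume "integral z"
    then obtain m c where c: "\<And>i. i < m \<Longrightarrow> c i \<in> D" "z ^ m = (\<Sum>i<m. c i * z ^ i)"
      by (auto simp: integral_def)
    define cs where "cs = 1 # rev (map (\<lambda>i. - c i) [0..<m])"
    have cs: "set cs \<subseteq> D" using c(1) by (auto simp: cs_def D_1 intro: D_uminus)
    have "(\<Sum>i<length cs. rev cs ! i * z ^ i) = (\<Sum>i<m. - c i * z ^ i) + z ^ m"
      by (simp add: cs_def nth_append)
    also have "\<dots> = 0" using c(2) by (simp add: sum_negf)
    finally have "ring.eval K (map F cs) (F z) = F 0" using K_eval[OF z cs] by simp
    then show "integral_over K (to_fraction_field Q ` carrier Q) (F z)"
      unfolding integral_over_def img K_1 K_0 using cs
      by (intro exI[of _ "map F cs"]) (auto simp: cs_def)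
  qed
qed

lemma carrier_W: "carrier W = F ` V"
  by (auto simp: integral_closure_def carrier_K integral_over_K_iff V_def)

lemma V_L: "z \<in> V \<Longrightarrow> z \<in> L" by (simp add: V_def)

lemma W_ops: "\<one>\<^bsub>W\<^esub> = F 1" "\<zero>\<^bsub>W\<^esub> = F 0"
    "z \<in> V \<Longrightarrow> w \<in> V \<Longrightarrow> F z \<otimes>\<^bsub>W\<^esub> F w = F (z * w)"
    "z \<in> V \<Longrightarrow> w \<in> V \<Longrightarrow> F z \<oplus>\<^bsub>W\<^esub> F w = F (z + w)"
  using K_1 K_0 K_mult K_add by (auto simp: integral_closure_def V_L)

lemma cring_W: "cring W"
  by (rule cring_of_image[OF carrier_W]) (simp_all add: V_0 V_1 V_add V_mult V_uminus W_ops)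

lemma W_power:
  assumes "z \<in> V"
  shows "F z [^]\<^bsub>W\<^esub> (k::nat) = F (z ^ k)"
proof -
  interpret W: cring W by (rule cring_W)
  show ?thesis
    by (induction k) (simp_all add: W_ops V_power assms mult.commute)
qed

lemma W_eq_iff: "z \<in> V \<Longrightarrow> w \<in> V \<Longrightarrow> F z = F w \<longleftrightarrow> z = w"
  by (simp add: F_eq_iff V_L)

lemma Units_W: "Units W = F ` {u \<in> V. u \<noteq> 0 \<and> inverse u \<in> V}"
proof -
  have "F u \<in> Units W \<longleftrightarrow> u \<noteq> 0 \<and> inverse u \<in> V" if u: "u \<in> V" for u
  proof -
    have "F u \<in> Units W \<longleftrightarrow> (\<exists>w\<in>V. w * u = 1)"
      using u by (auto simp: Units_def carrier_W W_ops W_eq_iff V_mult V_1 mult.commute)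
    also have "\<dots> \<longleftrightarrow> u \<noteq> 0 \<and> inverse u \<in> V"
      by (metis inverse_unique left_inverse mult.commute mult_zero_left zero_neq_one)
    finally show ?thesis .
  qed
  moreover have "Units W \<subseteq> F ` V" by (auto simp: Units_def carrier_W)
  ultimately show ?thesis by blast
qed

lemma PIdl_W: "p \<in> V \<Longrightarrow> PIdl\<^bsub>W\<^esub> (F p) = F ` {a * p | a. a \<in> V}"
proof -
  assume p: "p \<in> V"
  have "PIdl\<^bsub>W\<^esub> (F p) = (\<lambda>x. x \<otimes>\<^bsub>W\<^esub> F p) ` F ` V"
    unfolding cgenideal_def carrier_W by blast
  also have "\<dots> = (\<lambda>a. F (a * p)) ` V"
    unfolding image_image by (rule image_cong) (simp_all add: W_ops p)
  finally show ?thesis by blast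
qed

lemma zero_in_PIdl_W: "p \<in> V \<Longrightarrow> F 0 \<in> PIdl\<^bsub>W\<^esub> (F p)"
  unfolding PIdl_W by (rule image_eqI[of _ _ 0], simp, rule CollectI, rule exI[of _ 0]) (simp add: V_0)

definition uniformizer :: "'o \<Rightarrow> bool" where
  "uniformizer p \<longleftrightarrow> p \<in> V \<and> p \<noteq> 0 \<and> inverse p \<notin> V \<and>
     (\<forall>z\<in>V. z \<noteq> 0 \<longrightarrow> (\<exists>u k. u \<in> V \<and> inverse u \<in> V \<and> z = u * p ^ k))"

lemma uniformizer_ex: "\<exists>p. uniformizer p"
  using uniformizer_exists by (auto simp: uniformizer_def)

text \<open>An element of an ideal outside the multiples of \<open>p\<close> is a unit times \<open>p\<^sup>0\<close>.\<close>

lemma uniformizer_maximal: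
  assumes p: "uniformizer p"
  shows "maximalideal (PIdl\<^bsub>W\<^esub> (F p)) W"
proof -
  interpret W: cring W by (rule cring_W)
  have pV: "p \<in> V" "p \<noteq> 0" "inverse p \<notin> V" using p by (auto simp: uniformizer_def)
  show ?thesis
  proof (rule maximalidealI)
    show "ideal (PIdl\<^bsub>W\<^esub> (F p)) W" by (rule W.cgenideal_ideal) (simp add: carrier_W pV)
    show "carrier W \<noteq> PIdl\<^bsub>W\<^esub> (F p)"
    proof
      assume "carrier W = PIdl\<^bsub>W\<^esub> (F p)"
      then have "F 1 \<in> F ` {a * p | a. a \<in> V}" using carrier_W PIdl_W[OF pV(1)] V_1 by blast
      then obtain a where "a \<in> V" "F 1 = F (a * p)" by blast
      then have "a * p = 1" using W_eq_iff[OF V_1 V_mult] pV by metis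
      then show False using \<open>a \<in> V\<close> pV by (metis inverse_unique mult.commute)
    qed
    fix J assume J: "ideal J W" "PIdl\<^bsub>W\<^esub> (F p) \<subseteq> J" "J \<subseteq> carrier W"
    show "J = PIdl\<^bsub>W\<^esub> (F p) \<or> J = carrier W"
    proof (cases "J \<subseteq> PIdl\<^bsub>W\<^esub> (F p)")
      case False
      then obtain z where z: "z \<in> V" "F z \<in> J" "F z \<notin> PIdl\<^bsub>W\<^esub> (F p)"
      proof -
        obtain y where y: "y \<in> J" "y \<notin> PIdl\<^bsub>W\<^esub> (F p)" using False by blast
        then have "y \<in> F ` V" using J(3) unfolding carrier_W by blast
        then show ?thesis using that y by blast
      qed
      have z0: "z \<noteq> 0" using z(3) zero_in_PIdl_W[OF pV(1)] by metis
      obtain u k where u: "u \<in> V" "inverse u \<in> V" "z = u * p ^ k"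
        using p z z0 by (auto simp: uniformizer_def)
      have "k = 0"
      proof (rule ccontr)
        assume "k \<noteq> 0"
        then obtain l where "k = Suc l" by (cases k) auto
        then have "z = (u * p ^ l) * p" by (simp add: u(3) mult.assoc mult.commute)
        moreover have "u * p ^ l \<in> V" by (intro V_mult V_power u pV)
        ultimately have "F z \<in> PIdl\<^bsub>W\<^esub> (F p)" unfolding PIdl_W[OF pV(1)] by blast
        then show False using z(3) by simp
      qed
      then have "z = u" using u by simp
      have "F (inverse u) \<otimes>\<^bsub>W\<^esub> F z \<in> J"
        using ideal.I_l_closed[OF J(1) z(2)] u by (auto simp: carrier_W)
      then have "\<one>\<^bsub>W\<^esub> \<in> J" using u z0 by (simp add: W_ops \<open>z = u\<close>)
      then show ?thesis using ideal.one_imp_carrier[OF J(1)] by simp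
    qed (use J in blast)
  qed
qed

lemma uniformizer_power_le:
  assumes p: "uniformizer p" and u: "u \<in> V" "inverse u \<in> V" "u \<noteq> 0" "w \<in> V" "u * p ^ k = w * p ^ l"
  shows "l \<le> k"
proof (rule ccontr)
  have pV: "p \<in> V" "p \<noteq> 0" "inverse p \<notin> V" using p by (auto simp: uniformizer_def)
  assume "\<not> l \<le> k"
  then obtain j where j: "l = k + Suc j" by (metis add_Suc_right less_imp_Suc_add not_le)
  have "p ^ k * u = p ^ k * (w * p ^ j * p)" using u(5) by (simp add: j power_add mult_ac)
  then have "u = w * p ^ j * p" using pV by simp
  then have "p * (inverse u * w * p ^ j) = 1" using u(3) by (simp add: field_simps)
  then have "inverse p = inverse u * w * p ^ j" by (rule inverse_unique)
  then show False using V_mult[OF V_mult[OF u(2,4)] V_power[OF pV(1)]] pV by simp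
qed

lemma uniformizer_power_unique:
  assumes "uniformizer p" "u \<in> V" "inverse u \<in> V" "u \<noteq> 0" "w \<in> V" "inverse w \<in> V" "w \<noteq> 0"
    "u * p ^ k = w * p ^ l"
  shows "k = l"
  using uniformizer_power_le[of p u w k l] uniformizer_power_le[of p w u l k] assms
  by (intro antisym) auto

text \<open>The maximal ideal of \<open>V\<close> is unique. So the number that \<open>dvr_valuation\<close> describes does not depend on
  the generator that is chosen there.\<close>

lemma maximal_generator:
  assumes p: "uniformizer p" and q: "q \<in> V" "maximalideal (PIdl\<^bsub>W\<^esub> (F q)) W"
  shows "\<exists>w. w \<in> V \<and> inverse w \<in> V \<and> w \<noteq> 0 \<and> q = w * p"
proof -
  interpret W: cring W by (rule cring_W)
  have pV: "p \<in> V" "p \<noteq> 0" "inverse p \<notin> V" using p by (auto simp: uniformizer_def)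
  have max: "ideal (PIdl\<^bsub>W\<^esub> (F p)) W" "PIdl\<^bsub>W\<^esub> (F p) \<noteq> carrier W"
    using uniformizer_maximal[OF p] maximalideal.I_notcarr maximalideal.axioms(1) by blast+
  have eqI: "PIdl\<^bsub>W\<^esub> (F q) = PIdl\<^bsub>W\<^esub> (F p)" if "PIdl\<^bsub>W\<^esub> (F q) \<subseteq> PIdl\<^bsub>W\<^esub> (F p)"
    using maximalideal.I_maximal[OF q(2) max(1) that] max W.cgenideal_ideal ideal.Icarr[OF max(1)] by blast
  have memp: "F p \<in> PIdl\<^bsub>W\<^esub> (F p)" by (rule W.cgenideal_self) (simp add: carrier_W pV)
  have "q \<noteq> 0"
  proof
    assume q0: "q = 0"
    have "PIdl\<^bsub>W\<^esub> (F q) \<subseteq> {F 0}" unfolding PIdl_W[OF q(1)] by (auto simp: q0)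
    then have "PIdl\<^bsub>W\<^esub> (F p) \<subseteq> {F 0}" using eqI zero_in_PIdl_W[OF pV(1)] by blast
    then have "F p = F 0" using memp by blast
    then show False using W_eq_iff pV V_0 by blast
  qed
  then obtain w k where w: "w \<in> V" "inverse w \<in> V" "q = w * p ^ k"
    using p q by (auto simp: uniformizer_def)
  have w0: "w \<noteq> 0" using \<open>q \<noteq> 0\<close> w by auto
  have "k \<noteq> 0"
  proof
    assume "k = 0"
    then have "1 = inverse w * q" using w(3) w0 by simp
    then have "F 1 \<in> PIdl\<^bsub>W\<^esub> (F q)" unfolding PIdl_W[OF q(1)] using w(2) by blast
    then have "\<one>\<^bsub>W\<^esub> \<in> PIdl\<^bsub>W\<^esub> (F q)" by (simp add: W_ops)
    then show False
      using ideal.one_imp_carrier[OF maximalideal.axioms(1)[OF q(2)]] maximalideal.I_notcarr[OF q(2)] by simp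
  qed
  then obtain l where l: "k = Suc l" by (cases k) auto
  have "PIdl\<^bsub>W\<^esub> (F q) \<subseteq> PIdl\<^bsub>W\<^esub> (F p)"
  proof -
    have "a * q = (a * (w * p ^ l)) * p" for a by (simp add: w(3) l mult_ac)
    moreover have "a * (w * p ^ l) \<in> V" if "a \<in> V" for a by (intro V_mult V_power that w pV)
    ultimately show ?thesis unfolding PIdl_W[OF q(1)] PIdl_W[OF pV(1)] by blast
  qed
  then have "F p \<in> PIdl\<^bsub>W\<^esub> (F q)" using eqI memp by simp
  then obtain a where a: "a \<in> V" "F p = F (a * q)" using PIdl_W q by blast
  then have "1 * p ^ 1 = (a * w) * p ^ k"
    using W_eq_iff[OF pV(1) V_mult[OF a(1) q(1)]] by (simp add: w(3) mult.assoc)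
  then have "k \<le> 1"
    using uniformizer_power_le[OF p, of 1 "a * w" 1 k] V_1 V_mult[OF a(1) w(1)] by simp
  then have "k = 1" using \<open>k \<noteq> 0\<close> by simp
  then show ?thesis using w w0 by auto
qed

lemma dvr_valuation_uniformizer:
  assumes p: "uniformizer p" and u: "u \<in> V" "inverse u \<in> V" "u \<noteq> 0"
  shows "dvr_valuation W (F (u * p ^ k)) = enat k"
proof -
  have pV: "p \<in> V" "p \<noteq> 0" "inverse p \<notin> V" using p by (auto simp: uniformizer_def)
  have zV: "u * p ^ k \<in> V" by (intro V_mult V_power u pV)
  have "F (u * p ^ k) \<noteq> \<zero>\<^bsub>W\<^esub>"
    using W_eq_iff[OF zV V_0] u pV by (simp add: W_ops)
  moreover have "(THE n. \<exists>q v. q \<in> carrier W \<and> maximalideal (PIdl\<^bsub>W\<^esub> q) W \<and>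
      v \<in> Units W \<and> F (u * p ^ k) = v \<otimes>\<^bsub>W\<^esub> q [^]\<^bsub>W\<^esub> (n::nat)) = k"
  proof (rule the_equality)
    show "\<exists>q v. q \<in> carrier W \<and> maximalideal (PIdl\<^bsub>W\<^esub> q) W \<and>
      v \<in> Units W \<and> F (u * p ^ k) = v \<otimes>\<^bsub>W\<^esub> q [^]\<^bsub>W\<^esub> k"
      using uniformizer_maximal[OF p] u pV
      by (intro exI[of _ "F p"] exI[of _ "F u"]) (auto simp: carrier_W Units_W W_power W_ops V_power)
  next
    fix m :: nat assume "\<exists>q v. q \<in> carrier W \<and> maximalideal (PIdl\<^bsub>W\<^esub> q) W \<and>
      v \<in> Units W \<and> F (u * p ^ k) = v \<otimes>\<^bsub>W\<^esub> q [^]\<^bsub>W\<^esub> m"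
    then obtain q v where q: "q \<in> V" "maximalideal (PIdl\<^bsub>W\<^esub> (F q)) W"
      and v: "v \<in> V" "inverse v \<in> V" "v \<noteq> 0" and eq: "F (u * p ^ k) = F v \<otimes>\<^bsub>W\<^esub> F q [^]\<^bsub>W\<^esub> m"
      by (auto simp: carrier_W Units_W)
    obtain w where w: "w \<in> V" "inverse w \<in> V" "w \<noteq> 0" "q = w * p"
      using maximal_generator[OF p q] by blast
    have "F (u * p ^ k) = F (v * q ^ m)" using eq by (simp add: W_power W_ops V_power q v)
    then have "u * p ^ k = v * q ^ m" using W_eq_iff[OF zV] V_mult V_power q v by blast
    then have e: "u * p ^ k = (v * w ^ m) * p ^ m" by (simp add: w(4) power_mult_distrib mult.assoc)
    have "inverse (v * w ^ m) \<in> V"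
      using V_mult[OF v(2) V_power[OF w(2), of m]] by (simp add: power_inverse)
    then show "m = k"
      using uniformizer_power_unique[OF p u _ _ _ e] V_mult[OF v(1) V_power[OF w(1)]] v w by simp
  qed
  ultimately show ?thesis by (simp add: dvr_valuation_def)
qed

definition valuation :: "'o \<Rightarrow> enat" where "valuation z = dvr_valuation W (F z)"

lemma valuation_0: "valuation 0 = \<infinity>"
  by (simp add: valuation_def dvr_valuation_def W_ops)

lemma valuation_eq_infinity_iff: "z \<in> V \<Longrightarrow> valuation z = \<infinity> \<longleftrightarrow> z = 0"
proof -
  assume z: "z \<in> V"
  obtain p where p: "uniformizer p" using uniformizer_ex by blast
  show ?thesis
  proof (cases "z = 0")
    case False
    then obtain u k where u: "u \<in> V" "inverse u \<in> V" "z = u * p ^ k"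
      using p z by (auto simp: uniformizer_def)
    then have "valuation z = enat k"
      using False dvr_valuation_uniformizer[OF p u(1,2)] by (auto simp: valuation_def)
    then show ?thesis using False by simp
  qed (simp add: valuation_0)
qed

lemma valuation_mult:
  assumes z: "z \<in> V" "w \<in> V"
  shows "valuation (z * w) = valuation z + valuation w"
proof (cases "z = 0 \<or> w = 0")
  case False
  obtain p where p: "uniformizer p" using uniformizer_ex by blast
  obtain u k where u: "u \<in> V" "inverse u \<in> V" "z = u * p ^ k"
    using p z False by (auto simp: uniformizer_def)
  obtain v l where v: "v \<in> V" "inverse v \<in> V" "w = v * p ^ l"
    using p z False by (auto simp: uniformizer_def)
  have uv: "u * v \<in> V" "inverse (u * v) \<in> V" "u * v \<noteq> 0"
    using u v V_mult False by auto
  have "z * w = (u * v) * p ^ (k + l)" by (simp add: u v power_add mult_ac)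
  then have "valuation (z * w) = enat (k + l)"
    using dvr_valuation_uniformizer[OF p uv] by (simp add: valuation_def)
  moreover have "valuation z = enat k" "valuation w = enat l"
    using dvr_valuation_uniformizer[OF p u(1,2)] dvr_valuation_uniformizer[OF p v(1,2)] False
    by (auto simp: valuation_def u(3) v(3))
  ultimately show ?thesis by simp
qed (auto simp: valuation_0)

lemma valuation_eq_0_iff:
  assumes z: "z \<in> V"
  shows "valuation z = 0 \<longleftrightarrow> z \<noteq> 0 \<and> inverse z \<in> V"
proof (cases "z = 0")
  case False
  obtain p where p: "uniformizer p" using uniformizer_ex by blast
  obtain u k where u: "u \<in> V" "inverse u \<in> V" "z = u * p ^ k"
    using p z False by (auto simp: uniformizer_def)
  have u0: "u \<noteq> 0" using u False by auto
  have "valuation z = enat k"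
    using dvr_valuation_uniformizer[OF p u(1,2) u0] by (simp add: valuation_def u(3))
  moreover have "inverse z \<in> V" if "k = 0" using that u by simp
  moreover have "k = 0" if "inverse z \<in> V"
    using uniformizer_power_unique[OF p z that False u(1,2) u0, of 0 k] u(3) by simp
  ultimately show ?thesis using False by (auto simp: zero_enat_def)
qed (simp add: valuation_0)

end


section \<open>Values of plane curves\<close>

lemma type_ring_simps:
  "carrier (ring_of_type_algebra :: 'a::comm_ring_1 ring) = UNIV"
  "x \<otimes>\<^bsub>ring_of_type_algebra\<^esub> y = x * (y :: 'a)"
  "x \<oplus>\<^bsub>ring_of_type_algebra\<^esub> y = x + (y :: 'a)"
  "\<one>\<^bsub>ring_of_type_algebra\<^esub> = (1 :: 'a)"
  "\<zero>\<^bsub>ring_of_type_algebra\<^esub> = (0 :: 'a)"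
  by (simp_all add: ring_of_type_algebra_def)

lemma domain_type_ring: "domain (ring_of_type_algebra :: 'a::idom ring)"
  by (rule domain.intro[OF cring_from_type_algebra], unfold_locales) (auto simp: type_ring_simps)

lemma Units_type_ring: "Units (ring_of_type_algebra :: 'a::comm_ring_1 ring) = {u. u dvd 1}"
  by (auto simp: Units_def type_ring_simps dvd_def mult.commute)

lemma PIdl_type_ring: "PIdl\<^bsub>ring_of_type_algebra\<^esub> (a :: 'a::comm_ring_1) = {b. a dvd b}"
  by (auto simp: cgenideal_def type_ring_simps dvd_def mult.commute)

lemma coset_type_ring: "I +>\<^bsub>ring_of_type_algebra\<^esub> (a :: 'a::comm_ring_1) = {b. b - a \<in> I}"
  by (force simp: a_r_coset_def' type_ring_simps)

lemma type_ring_irreducible_imp_irreducible: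
  fixes a :: "'a::idom"
  assumes "ring_irreducible\<^bsub>ring_of_type_algebra\<^esub> a"
  shows "Factorial_Ring.irreducible a"
proof (rule irreducibleI)
  interpret domain "ring_of_type_algebra :: 'a ring" by (rule domain_type_ring)
  have a: "a \<in> carrier ring_of_type_algebra" by (simp add: type_ring_simps)
  note E = ring_irreducibleE[OF a assms]
  show "a \<noteq> 0" "\<not> a dvd 1"
    using E(1,4) by (auto simp: type_ring_simps Units_type_ring)
  fix b c assume "a = b * c"
  then show "b dvd 1 \<or> c dvd 1"
    using E(5)[of b c] by (simp add: type_ring_simps Units_type_ring)
qed

lemma associated_type_ring_iff:
  "a \<sim>\<^bsub>ring_of_type_algebra\<^esub> b \<longleftrightarrow> a dvd b \<and> b dvd (a :: 'a::comm_ring_1)"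
  by (auto simp: associated_def factor_def type_ring_simps dvd_def)

lemma fps_fps_dvd_1_iff:
  fixes g :: "'k::field fps fps"
  shows "g dvd 1 \<longleftrightarrow> fps_nth (fps_nth g 0) 0 \<noteq> 0"
proof
  assume "g dvd 1"
  then obtain h where "1 = g * h" by (elim dvdE)
  then have "fps_nth (fps_nth (g * h) 0) 0 = 1" by (metis fps_one_nth)
  then show "fps_nth (fps_nth g 0) 0 \<noteq> 0" by auto
qed (auto intro: fps_dvd_1_if_nth_0_dvd_1)

text \<open>The coset of \<open>g\<close> modulo the kernel \<open>\<langle>f\<^sub>i\<rangle>\<close> of \<open>\<phi>\<close> is the fiber of \<open>\<phi>\<close> over \<open>\<phi> g\<close>.\<close>

lemma curve_model_ring_branch:
  fixes f :: "'i \<Rightarrow> 'k::field fps fps"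
  assumes \<phi>: "branch_parametrization (f i) \<phi>" and n: "curve_model series_embedding (range \<phi>) n"
  shows "curve_model_ring series_embedding (range \<phi>) n (branch_ring f i) (\<lambda>d. \<phi> -` {d})"
proof -
  let ?I = "{b. f i dvd b}"
  have one: "\<phi> 1 = 1" and add: "\<phi> (g + h) = \<phi> g + \<phi> h" and mult: "\<phi> (g * h) = \<phi> g * \<phi> h"
    and zero: "\<phi> g = 0 \<longleftrightarrow> f i dvd g" for g h
    using \<phi> by (auto simp: branch_parametrization_def)
  have diff: "\<phi> (g - h) = \<phi> g - \<phi> h" for g h
    using add[of "g - h" h] by (simp add: algebra_simps)
  have coset: "?I +>\<^bsub>ring_of_type_algebra\<^esub> g = \<phi> -` {\<phi> g}" for g
    by (auto simp: coset_type_ring diff simp flip: zero)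
  note Q = branch_ring_def PIdl_type_ring FactRing_def
  show ?thesis
  proof (intro curve_model_ring.intro curve_model_ring_axioms.intro n)
    show "carrier (branch_ring f i) = (\<lambda>d. \<phi> -` {d}) ` range \<phi>"
      by (auto simp: Q A_RCOSETS_def' coset type_ring_simps)
    show "inj_on (\<lambda>d. \<phi> -` {d}) (range \<phi>)"
      by (auto simp: inj_on_def)
    show "\<one>\<^bsub>branch_ring f i\<^esub> = \<phi> -` {1}"
      by (simp add: Q coset type_ring_simps one)
    show "\<zero>\<^bsub>branch_ring f i\<^esub> = \<phi> -` {0}"
      by (auto simp: Q zero)
  next
    fix a b assume "a \<in> range \<phi>" "b \<in> range \<phi>"
    then obtain g h where gh: "a = \<phi> g" "b = \<phi> h" by blast
    have "(\<Union>x\<in>\<phi> -` {a}. \<Union>y\<in>\<phi> -` {b}. \<phi> -` {\<phi> (x * y)}) = \<phi> -` {a * b}"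
      using gh by (auto simp: mult)
    then show "\<phi> -` {a} \<otimes>\<^bsub>branch_ring f i\<^esub> \<phi> -` {b} = \<phi> -` {a * b}"
      by (simp add: Q rcoset_mult_def coset type_ring_simps)
    \<comment> \<open>A sum of two fibers is the whole fiber over the sum: subtract any element of the first one.\<close>
    have "z \<in> \<phi> -` {a} <+>\<^bsub>ring_of_type_algebra\<^esub> \<phi> -` {b}" if "\<phi> z = a + b" for z
    proof -
      have "z = g + (z - g)" by simp
      moreover have "g \<in> \<phi> -` {a}" "z - g \<in> \<phi> -` {b}" using that gh by (auto simp: diff)
      ultimately show ?thesis unfolding set_add_def' type_ring_simps by blast
    qed
    then have "\<phi> -` {a} <+>\<^bsub>ring_of_type_algebra\<^esub> \<phi> -` {b} = \<phi> -` {a + b}"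
      by (auto simp: set_add_def' type_ring_simps add)
    then show "\<phi> -` {a} \<oplus>\<^bsub>branch_ring f i\<^esub> \<phi> -` {b} = \<phi> -` {a + b}"
      by (simp add: Q)
  qed
qed

lemma to_branch_ring_to_curve_ring:
  fixes f :: "'i \<Rightarrow> 'k::field fps fps"
  shows "to_branch_ring f i (to_curve_ring f g) = {b. f i dvd b - g}"
proof -
  have "b \<in> to_branch_ring f i (to_curve_ring f g)" if "f i dvd b - g" for b
  proof -
    have "b = (b - g) + g" by simp
    moreover have "g \<in> to_curve_ring f g"
      by (simp add: to_curve_ring_def coset_type_ring curve_ideal_def PIdl_type_ring)
    ultimately show ?thesis
      using that unfolding to_branch_ring_def set_add_def' type_ring_simps PIdl_type_ring by blast
  qed
  moreover have "f i dvd b - g" if b: "b \<in> to_branch_ring f i (to_curve_ring f g)" for b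
  proof -
    obtain c d where cd: "b = c + d" "f i dvd c" "f i dvd d - g"
      using b by (auto simp: to_branch_ring_def to_curve_ring_def set_add_def' type_ring_simps
          coset_type_ring curve_ideal_def PIdl_type_ring)
    have "b - g = c + (d - g)" by (simp add: cd(1))
    then show ?thesis using cd by (metis dvd_add)
  qed
  ultimately show ?thesis by blast
qed

text \<open>Transported to the image of \<open>\<phi>\<close>, these are the properties of the valuation of \<open>V\<close>. For the last one,
  a unit of \<open>V\<close> in the image of \<open>\<phi>\<close> has its inverse in this image, so \<open>g h \<equiv> 1\<close> modulo \<open>f\<^sub>i\<close> for
  some \<open>h\<close>; as the constant coefficient of \<open>f\<^sub>i\<close> is 0, that of \<open>g\<close> is not.\<close>

lemma branch_valuation_properties:
  fixes f :: "'i \<Rightarrow> 'k::field fps fps"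
  assumes irr: "Factorial_Ring.irreducible (f i)"
  shows "branch_valuation f i (to_curve_ring f (g * h)) =
           branch_valuation f i (to_curve_ring f g) + branch_valuation f i (to_curve_ring f h)"
    and "branch_valuation f i (to_curve_ring f g) = \<infinity> \<longleftrightarrow> f i dvd g"
    and "branch_valuation f i (to_curve_ring f g) = 0 \<longleftrightarrow> g dvd 1"
proof -
  obtain \<phi> where \<phi>: "branch_parametrization (f i) \<phi>"
    using branch_parametrization_exists[OF irr] by blast
  then obtain n where n: "curve_model series_embedding (range \<phi>) n"
    by (auto simp: branch_parametrization_def)
  interpret B: curve_model_ring series_embedding "range \<phi>" n "branch_ring f i" "\<lambda>d. \<phi> -` {d}"
    by (rule curve_model_ring_branch[where f = f, OF \<phi> n])
  have one: "\<phi> 1 = 1" and add: "\<phi> (g + h) = \<phi> g + \<phi> h" and mult: "\<phi> (g * h) = \<phi> g * \<phi> h"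
    and zero: "\<phi> g = 0 \<longleftrightarrow> f i dvd g" for g h
    using \<phi> by (auto simp: branch_parametrization_def)
  have diff: "\<phi> (g - h) = \<phi> g - \<phi> h" for g h
    using add[of "g - h" h] by (simp add: algebra_simps)
  have val: "branch_valuation f i (to_curve_ring f g) = B.valuation (\<phi> g)" for g
  proof -
    have "to_branch_ring f i (to_curve_ring f g) = \<phi> -` {\<phi> g}"
      by (auto simp: to_branch_ring_to_curve_ring diff simp flip: zero)
    then show ?thesis by (simp add: branch_valuation_def B.valuation_def B.to_K)
  qed
  have V: "\<phi> g \<in> B.V" for g by (simp add: B.D_V)
  show "branch_valuation f i (to_curve_ring f (g * h)) =
      branch_valuation f i (to_curve_ring f g) + branch_valuation f i (to_curve_ring f h)"
    by (simp add: val mult B.valuation_mult V)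
  show "branch_valuation f i (to_curve_ring f g) = \<infinity> \<longleftrightarrow> f i dvd g"
    by (simp add: val B.valuation_eq_infinity_iff V zero)
  have "g dvd 1 \<longleftrightarrow> \<phi> g \<noteq> 0 \<and> inverse (\<phi> g) \<in> B.V"
  proof
    assume "g dvd 1"
    then obtain h where "1 = g * h" by (elim dvdE)
    then have gh: "\<phi> g * \<phi> h = 1" by (simp add: one flip: mult)
    then have "\<phi> g \<noteq> 0" "inverse (\<phi> g) = \<phi> h" by (auto intro: inverse_unique)
    then show "\<phi> g \<noteq> 0 \<and> inverse (\<phi> g) \<in> B.V" by (simp add: V)
  next
    assume *: "\<phi> g \<noteq> 0 \<and> inverse (\<phi> g) \<in> B.V"
    then have "inverse (\<phi> g) \<in> range \<phi>" by (intro B.inverse_in_D_if_in_V) auto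
    then obtain h where "inverse (\<phi> g) = \<phi> h" by blast
    then have "\<phi> (g * h - 1) = 0" using * by (simp add: diff mult one flip: \<open>inverse (\<phi> g) = \<phi> h\<close>)
    then obtain k where k: "g * h - 1 = f i * k" by (auto simp: zero elim: dvdE)
    have "fps_nth (fps_nth (f i) 0) 0 = 0"
      using irreducible_not_unit[OF irr] by (simp add: fps_fps_dvd_1_iff)
    moreover have "fps_nth (fps_nth (g * h) 0) 0 = 1 + fps_nth (fps_nth (f i * k) 0) 0"
      by (simp flip: k)
    ultimately have "fps_nth (fps_nth g 0) 0 \<noteq> 0" by auto
    then show "g dvd 1" by (simp add: fps_fps_dvd_1_iff)
  qed
  then show "branch_valuation f i (to_curve_ring f g) = 0 \<longleftrightarrow> g dvd 1"
    by (simp add: val B.valuation_eq_0_iff V)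
qed

lemma value_set_eq: "value_set f = range (\<lambda>g. value_vector f (to_curve_ring f g))"
proof -
  have "carrier (curve_ring f) = range (to_curve_ring f)"
    by (auto simp: curve_ring_def to_curve_ring_def FactRing_def A_RCOSETS_def' type_ring_simps)
  then show ?thesis by (simp add: value_set_def image_image)
qed

theorem proposition21:
  fixes f :: "'i::finite \<Rightarrow> 'k::alg_closed_field fps fps"
  assumes "CARD('i) \<ge> 2"
    and "branch_equations f"
    and "nondegenerate_curve f"
  shows "{\<gamma>. irreducible_point (value_set f) \<gamma> \<and> absolute_point (value_set f) \<gamma> \<and>
             (\<exists>i. \<gamma> $ i = \<infinity>)} =
         range (\<lambda>i. value_vector f (to_curve_ring f (f i)))"
proof -
  define v where "v i g = branch_valuation f i (to_curve_ring f g)" for i g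
  define vv where "vv g = value_vector f (to_curve_ring f g)" for g
  have vv_nth: "vec_nth (vv g) i = v i g" for g i
    by (simp add: vv_def value_vector_def v_def)
  have irr: "Factorial_Ring.irreducible (f i)" for i
    using assms(2) type_ring_irreducible_imp_irreducible by (auto simp: branch_equations_def)
  have v_mult: "v i (g * h) = v i g + v i h" and v_infinity: "v i g = \<infinity> \<longleftrightarrow> f i dvd g"
    and v_0: "v i g = 0 \<longleftrightarrow> g dvd 1" for i g h
    unfolding v_def by (rule branch_valuation_properties[where f = f, OF irr])+
  have nonunit: "\<not> f i dvd 1" for i
    using irreducible_not_unit[OF irr] .
  have not_dvd: "\<not> f j dvd f i" if "i \<noteq> j" for i j
  proof
    assume "f j dvd f i"
    then obtain c where c: "f i = f j * c" by (elim dvdE)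
    then have "c dvd 1" using irreducibleD[OF irr c] nonunit by blast
    then obtain d where "1 = c * d" by (elim dvdE)
    then have "f j = f i * d" by (simp add: c mult.assoc flip: \<open>1 = c * d\<close>)
    then have "f i \<sim>\<^bsub>power_series_ring\<^esub> f j"
      using \<open>f j dvd f i\<close> by (simp add: associated_type_ring_iff)
    then show False using that assms(2) by (auto simp: branch_equations_def)
  qed
  have vv_mult: "vv (g * h) = vv g + vv h" for g h
    by (simp add: vec_eq_iff vv_nth v_mult)
  have \<Gamma>: "value_set f = range vv" by (simp add: value_set_eq vv_def)
  have cancel: "b = 0" if "a + b = a" "a \<noteq> \<infinity>" for a b :: enat
    using that by (cases a; cases b) (auto simp: zero_enat_def)
  have other: "\<exists>j. j \<noteq> i" for i :: 'i
  proof (rule ccontr)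
    assume "\<nexists>j. j \<noteq> i"
    then have "UNIV = {i}" by auto
    then have "CARD('i) = card {i}" by (rule arg_cong)
    then show False using assms(1) by simp
  qed
  have "\<gamma> \<in> range (\<lambda>i. vv (f i))"
    if \<gamma>: "irreducible_point (value_set f) \<gamma>" "absolute_point (value_set f) \<gamma>" "vec_nth \<gamma> i = \<infinity>" for \<gamma> i
  proof -
    obtain g where g: "\<gamma> = vv g" using \<gamma>(1) by (auto simp: irreducible_point_def \<Gamma>)
    then have "f i dvd g" using \<gamma>(3) by (simp add: vv_nth v_infinity)
    then obtain h where h: "g = f i * h" by (elim dvdE)
    have "\<gamma> \<noteq> (\<chi> i. \<infinity>)" using \<gamma>(2) by (auto simp: absolute_point_def)
    then obtain j where j: "vec_nth \<gamma> j \<noteq> \<infinity>" by (auto simp: vec_eq_iff)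
    have "\<gamma> = vv (f i) + vv h" by (simp add: g h vv_mult)
    then have "vv (f i) = \<gamma> \<or> vv h = \<gamma>"
      using \<gamma>(1) by (auto simp: irreducible_point_def \<Gamma>)
    moreover have "vv h \<noteq> \<gamma>"
    proof
      assume "vv h = \<gamma>"
      then have "v j h + v j (f i) = v j h"
        using g h v_mult[of j "f i" h] by (metis add.commute vv_nth)
      then have "v j (f i) = 0" using cancel j \<open>vv h = \<gamma>\<close> vv_nth by metis
      then show False using v_0 nonunit by blast
    qed
    ultimately show ?thesis by blast
  qed
  moreover have "irreducible_point (value_set f) (vv (f i)) \<and> absolute_point (value_set f) (vv (f i))
      \<and> vec_nth (vv (f i)) i = \<infinity>" for i
  proof -
    obtain j where j: "j \<noteq> i" using other by blast
    have inf: "v k (f i) = \<infinity> \<longleftrightarrow> k = i" for k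
      using v_infinity not_dvd by (metis dvd_refl)
    have unit: "v k h = 0" if "v l h = 0" for k l h
      using that by (simp add: v_0)
    have factor: "\<exists>h. g = f i * h" if "v i g = \<infinity>" for g
      using that by (auto simp: v_infinity elim: dvdE)
    \<comment> \<open>The summand that is infinite at i is a multiple of f i, and the other one is 0.\<close>
    have irred: "vv g = vv (f i)" if gh: "vv (f i) = vv g + vv h" "v i g = \<infinity>" for g h
    proof -
      obtain g' where g': "g = f i * g'" using factor gh(2) by blast
      have "v j (f i) + (v j g' + v j h) = v j (f i)"
        using arg_cong[OF gh(1), of "\<lambda>x. vec_nth x j"] by (simp add: vv_nth g' v_mult add.assoc)
      then have "v j g' + v j h = 0" using cancel inf j by blast
      then have "v j h = 0" by simp
      then have "vv h = 0" using unit by (simp add: vec_eq_iff vv_nth)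
      then show ?thesis using gh(1) by simp
    qed
    have "vv (f i) \<noteq> 0"
      using inf[of i] vv_nth[of "f i" i] by (metis i0_ne_infinity zero_index)
    moreover have "vv g = vv (f i) \<or> vv h = vv (f i)" if gh: "vv (f i) = vv g + vv h" for g h
    proof -
      have "v i g + v i h = \<infinity>"
        using arg_cong[OF gh, of "\<lambda>x. vec_nth x i"] inf[of i] by (simp add: vv_nth)
      then consider "v i g = \<infinity>" | "v i h = \<infinity>" by (metis plus_eq_infty_iff_enat)
      then show ?thesis using irred[of g h] irred[of h g] gh by cases (auto simp: add.commute)
    qed
    ultimately have "irreducible_point (value_set f) (vv (f i))"
      by (auto simp: irreducible_point_def \<Gamma>)
    moreover have "absolute_point (value_set f) (vv (f i))"
    proof -
      have fc: "finite_coords (vv (f i)) = - {i}"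
        by (auto simp: finite_coords_def vv_nth inf)
      have "fiber (value_set f) J (vv (f i)) = {}" if J: "J \<noteq> {}" "J \<subset> - {i}" for J
      proof (rule ccontr)
        assume "fiber (value_set f) J (vv (f i)) \<noteq> {}"
        then obtain g where g: "vv g \<in> fiber (value_set f) J (vv (f i))"
          by (auto simp: fiber_def \<Gamma>)
        have gt: "v k g > v k (f i)" if "k \<noteq> i" "k \<notin> J" for k
          using g that by (simp add: fiber_def fc vv_nth)
        have eq: "v k g = v k (f i)" if "k = i \<or> k \<in> J" for k
          using g that J(2) by (auto simp: fiber_def fc vv_nth)
        have "v i g = \<infinity>" using eq[of i] inf[of i] by simp
        then obtain h where h: "g = f i * h" using factor by blast
        obtain k where k: "k \<in> J" using J by blast
        then have "k \<noteq> i" using J by blast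
        have "v k (f i) + v k h = v k (f i)" using eq[of k] k by (simp add: h v_mult)
        then have "v k h = 0" using cancel[of "v k (f i)" "v k h"] inf[of k] \<open>k \<noteq> i\<close> by simp
        obtain l where l: "l \<noteq> i" "l \<notin> J" using J by blast
        have "v l h = 0" by (rule unit[OF \<open>v k h = 0\<close>])
        then show False using gt[OF l] by (simp add: h v_mult)
      qed
      moreover have "vv (f i) \<noteq> (\<chi> i. \<infinity>)"
        using inf[of j] j by (auto simp: vec_eq_iff vv_nth)
      ultimately show ?thesis by (auto simp: absolute_point_def \<Gamma> fc)
    qed
    ultimately show ?thesis using inf by (simp add: vv_nth)
  qed
  ultimately show ?thesis unfolding vv_def[symmetric] by blast
qed


end
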